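(* Let $\pi: X \to Y$ be a factor code from an irreducible shift of finite type $X$ onto a sofic shift $Y$, and let $c_\pi$ be the class degree of $\pi$. Then there exist an irreducible sofic shift $\widetilde{Y}$ and factor codes $\pi_1: X \to \widetilde{Y}$ and $\pi_2: \widetilde{Y} \to Y$ such that $\pi = \pi_2 \circ \pi_1$, the factor code $\pi_1$ has class degree $1$, and the factor code $\pi_2$ is finite-to-one and has degree $c_\pi$.
   Context: Shift spaces are one-dimensional and two-sided: closed shift-invariant subsets of $\mathcal{A}^{\mathbb{Z}}$ with $\mathcal{A}$ a finite alphabet, together with the shift map $\sigma$. An $X$-word is a finite block occurring in some point of $X$. A shift of finite type (SFT) is a shift space defined by a finite set of forbidden blocks. A factor code is a continuous, surjective, shift-commuting map between shift spaces. A sofic shift is an image of an SFT under a factor code. A shift space $X$ is irreducible if for each pair of $X$-words $u,v$ there is an $X$-word $w$ such that $uwv$ is an $X$-word. A point $y$ of an irreducible sofic shift $Y$ is doubly transitive if both its forward orbit and its backward orbit are dense in $Y$. A factor code $\pi: X \to Y$ is finite-to-one if $\pi^{-1}(y)$ is a finite set for every $y \in Y$. The degree of a finite-to-one factor code $\pi$ from an irreducible sofic shift $X$ onto a sofic shift $Y$ is the unique $d \in \mathbb{N}$ such that $|\pi^{-1}(y)| = d$ for all doubly transitive points $y \in Y$ (it is known that such a $d$ exists). Class degree: let $\pi$ be a (possibly infinite-to-one) factor code from an irreducible SFT $X$ onto a sofic shift $Y$. For $x,x' \in X$ write $x \to x'$ if $\pi(x) = \pi(x') = y$ for some $y \in Y$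 and for each $n \in \mathbb{N}$ there is $x'' \in \pi^{-1}(y)$ such that $x''_{(-\infty,n]} = x_{(-\infty,n]}$ and $x''_{[i,\infty)} = x'_{[i,\infty)}$ for some $i > n$. Write $x \sim x'$ if $x \to x'$ and $x' \to x$; this is an equivalence relation on $X$ whose classes are called transition classes. The transition classes contained in $\pi^{-1}(y)$ are the transition classes over $y$; their number is finite for each $y \in Y$. The class degree of $\pi$ is the minimum, over all $y \in Y$, of the number of transition classes over $y$. *)

theory Defs
  imports "HOL-Analysis.Analysis"
begin

text \<open>The set \<open>A\<^sup>\<int>\<close> with its product topology is a subspace of the space below, so closedness,
  continuity and density for shift spaces over a finite alphabet can all be read off from it.\<close>

definition seq_topology :: "(int \<Rightarrow> 'a) topology" where
  "seq_topology = product_topology (\<lambda>_. discrete_topology UNIV) UNIV"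

text \<open>\<open>shift_pow k\<close> is the \<open>k\<close>-th iterate of the shift map, for any integer \<open>k\<close>.\<close>

definition shift_pow :: "int \<Rightarrow> (int \<Rightarrow> 'a) \<Rightarrow> (int \<Rightarrow> 'a)" where
  "shift_pow k x = (\<lambda>i. x (i + k))"

abbreviation shift :: "(int \<Rightarrow> 'a) \<Rightarrow> (int \<Rightarrow> 'a)" where
  "shift \<equiv> shift_pow 1"

definition shift_space :: "(int \<Rightarrow> 'a) set \<Rightarrow> bool" where
  "shift_space X \<longleftrightarrow>
     (\<exists>A. finite A \<and> X \<subseteq> {x. range x \<subseteq> A}) \<and> closedin seq_topology X \<and> shift ` X = X"

definition occurs_in :: "'a list \<Rightarrow> (int \<Rightarrow> 'a) \<Rightarrow> bool" where
  "occurs_in w x \<longleftrightarrow> (\<exists>i. \<forall>k<length w. x (i + int k) = w ! k)"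

definition words :: "(int \<Rightarrow> 'a) set \<Rightarrow> 'a list set" where
  "words X = {w. \<exists>x\<in>X. occurs_in w x}"

definition irreducible_shift :: "(int \<Rightarrow> 'a) set \<Rightarrow> bool" where
  "irreducible_shift X \<longleftrightarrow>
     shift_space X \<and> (\<forall>u\<in>words X. \<forall>v\<in>words X. \<exists>w\<in>words X. u @ w @ v \<in> words X)"

definition sft :: "(int \<Rightarrow> 'a) set \<Rightarrow> bool" where
  "sft X \<longleftrightarrow>
     (\<exists>A F. finite A \<and> finite F \<and> F \<subseteq> lists A \<and>
            X = {x. range x \<subseteq> A \<and> (\<forall>w\<in>F. \<not> occurs_in w x)})"

definition factor_code ::
  "((int \<Rightarrow> 'a) \<Rightarrow> (int \<Rightarrow> 'b)) \<Rightarrow> (int \<Rightarrow> 'a) set \<Rightarrow> (int \<Rightarrow> 'b) set \<Rightarrow> bool" where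
  "factor_code \<pi> X Y \<longleftrightarrow>
     shift_space X \<and> shift_space Y \<and>
     continuous_map (subtopology seq_topology X) (subtopology seq_topology Y) \<pi> \<and>
     \<pi> ` X = Y \<and> (\<forall>x\<in>X. \<pi> (shift x) = shift (\<pi> x))"

text \<open>Finite alphabets can be renamed injectively to sets of natural numbers, so letting the
  covering SFT have its symbols in \<open>nat\<close> loses no generality.\<close>

definition sofic :: "(int \<Rightarrow> 'a) set \<Rightarrow> bool" where
  "sofic Y \<longleftrightarrow> (\<exists>(Z :: (int \<Rightarrow> nat) set) \<phi>. sft Z \<and> factor_code \<phi> Z Y)"

definition doubly_transitive :: "(int \<Rightarrow> 'a) set \<Rightarrow> (int \<Rightarrow> 'a) \<Rightarrow> bool" where
  "doubly_transitive Y y \<longleftrightarrow> y \<in> Y \<and>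
     subtopology seq_topology Y closure_of (range (\<lambda>n. shift_pow (int n) y)) = Y \<and>
     subtopology seq_topology Y closure_of (range (\<lambda>n. shift_pow (- int n) y)) = Y"

definition fibre ::
  "((int \<Rightarrow> 'a) \<Rightarrow> (int \<Rightarrow> 'b)) \<Rightarrow> (int \<Rightarrow> 'a) set \<Rightarrow> (int \<Rightarrow> 'b) \<Rightarrow> (int \<Rightarrow> 'a) set" where
  "fibre \<pi> X y = {x \<in> X. \<pi> x = y}"

definition finite_to_one ::
  "((int \<Rightarrow> 'a) \<Rightarrow> (int \<Rightarrow> 'b)) \<Rightarrow> (int \<Rightarrow> 'a) set \<Rightarrow> (int \<Rightarrow> 'b) set \<Rightarrow> bool" where
  "finite_to_one \<pi> X Y \<longleftrightarrow> (\<forall>y\<in>Y. finite (fibre \<pi> X y))"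

text \<open>Only meaningful for a finite-to-one factor code between nonempty shift spaces with \<open>X\<close>
  irreducible and sofic; there the number described exists and is unique.\<close>

definition code_degree ::
  "((int \<Rightarrow> 'a) \<Rightarrow> (int \<Rightarrow> 'b)) \<Rightarrow> (int \<Rightarrow> 'a) set \<Rightarrow> (int \<Rightarrow> 'b) set \<Rightarrow> nat" where
  "code_degree \<pi> X Y = (THE d. \<forall>y. doubly_transitive Y y \<longrightarrow> card (fibre \<pi> X y) = d)"

definition transition ::
  "((int \<Rightarrow> 'a) \<Rightarrow> (int \<Rightarrow> 'b)) \<Rightarrow> (int \<Rightarrow> 'a) set \<Rightarrow> (int \<Rightarrow> 'a) \<Rightarrow> (int \<Rightarrow> 'a) \<Rightarrow> bool" where
  "transition \<pi> X x x' \<longleftrightarrow>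
     x \<in> X \<and> x' \<in> X \<and> \<pi> x = \<pi> x' \<and>
     (\<forall>n::nat. \<exists>x''\<in>fibre \<pi> X (\<pi> x).
        (\<forall>j\<le>int n. x'' j = x j) \<and> (\<exists>i>int n. \<forall>j\<ge>i. x'' j = x' j))"

definition transition_equiv ::
  "((int \<Rightarrow> 'a) \<Rightarrow> (int \<Rightarrow> 'b)) \<Rightarrow> (int \<Rightarrow> 'a) set \<Rightarrow> ((int \<Rightarrow> 'a) \<times> (int \<Rightarrow> 'a)) set" where
  "transition_equiv \<pi> X = {(x, x'). transition \<pi> X x x' \<and> transition \<pi> X x' x}"

definition transition_classes_over ::
  "((int \<Rightarrow> 'a) \<Rightarrow> (int \<Rightarrow> 'b)) \<Rightarrow> (int \<Rightarrow> 'a) set \<Rightarrow> (int \<Rightarrow> 'b) \<Rightarrow> (int \<Rightarrow> 'a) set set" where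
  "transition_classes_over \<pi> X y = {C \<in> X // transition_equiv \<pi> X. C \<subseteq> fibre \<pi> X y}"

text \<open>The number of classes over a point is always finite for an irreducible SFT \<open>X\<close>; the
  finiteness condition only keeps the value \<open>0\<close> of \<^const>\<open>card\<close> on infinite sets out of the minimum.\<close>

definition class_degree ::
  "((int \<Rightarrow> 'a) \<Rightarrow> (int \<Rightarrow> 'b)) \<Rightarrow> (int \<Rightarrow> 'a) set \<Rightarrow> (int \<Rightarrow> 'b) set \<Rightarrow> nat" where
  "class_degree \<pi> X Y =
     (LEAST c. \<exists>y\<in>Y. finite (transition_classes_over \<pi> X y) \<and>
                     card (transition_classes_over \<pi> X y) = c)"

end

theory Submission
  imports Defs
begin

text \<open>
  Fix a radius \<open>N\<close> that is large both for the memory of the SFT \<open>X\<close> and for the block map of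
  \<open>\<pi>\<close>, and call the window of \<open>x\<close> of radius \<open>N\<close> around \<open>i\<close> its state at \<open>i\<close>. Two points with a
  common state can be spliced there, and the image symbol depends only on the state. A word \<open>v\<close> over
  the alphabet of \<open>Y\<close> therefore acts as a relation \<open>T v\<close> between states, joined by a stretch of a
  point of \<open>X\<close> lying over \<open>v\<close>, and concatenation of words is composition of relations. So \<open>T\<close>
  has finite range, and irreducibility of \<open>X\<close> says that any two states are related by some \<open>T u\<close>.

  In this finite semigroup a nonempty idempotent \<open>e = T w\<close> with the fewest distinct images
  \<open>e `` Z\<close> is minimal, so the nonempty elements \<open>h = e O h = h O e\<close> form a group with identity
  \<open>e\<close> (\<open>unit_inverse\<close>). As any state can be joined back to any other, this group property forces
  \<open>e\<close> to be a disjoint union of rectangles: a pair \<open>(s, t) \<in> e\<close> factors through recurrent states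
  \<open>a\<close>, \<open>(a, a) \<in> e\<close>, and all of these are equivalent (\<open>mark_equiv\<close>). Their class is the mark of
  \<open>(s, t)\<close>. Units permute the marks (\<open>unit_forward\<close>, \<open>unit_backward\<close>).

  Let \<open>\<pi>\<^sub>1\<close> send \<open>x\<close> to \<open>\<pi> x\<close> decorated, at each occurrence of \<open>w\<close>, with the mark of the states
  at the two ends of the occurrence, and let \<open>\<pi>\<^sub>2\<close> forget the decoration. Over a fixed point of
  \<open>Y\<close>, the marks at two disjoint occurrences of \<open>w\<close> determine each other. Hence \<open>\<pi>\<^sub>2\<close> is
  finite-to-one, and by compactness its fibre over a point \<open>y\<close> in which \<open>w\<close> occurs infinitely often in
  both directions realizes every mark, so it has exactly \<open>d\<close> elements, \<open>d\<close> the number of marks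
  (\<open>card_mark_sequences\<close>). Doubly transitive points are of this kind, and exist by Baire's theorem.

  Two points with equal \<open>\<pi>\<close>-image and equal marks can be connected inside any common occurrence of
  \<open>w\<close> without changing the image or any mark. Over \<open>y\<close> as above this gives at most \<open>d\<close> transition
  classes for \<open>\<pi>\<close>, and just one for \<open>\<pi>\<^sub>1\<close> over each of its decorations. Conversely, over
  every point of \<open>Y\<close> there are at least \<open>d\<close> classes: each window can be
  embedded between two occurrences of \<open>w\<close>, the \<open>d\<close> marks at the left one start \<open>d\<close> tracks over the
  window, and a connection from one track to another would contradict that the marks at the two
  occurrences determine each other. A limit over growing windows yields \<open>d\<close> points without
  transitions between them (\<open>unlinked_tracks\<close>). So \<open>d\<close> is the class degree of \<open>\<pi>\<close>.
\<close>

section \<open>Sequence spaces and block codes\<close>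

definition agree :: "nat \<Rightarrow> (int \<Rightarrow> 'a) \<Rightarrow> (int \<Rightarrow> 'a) \<Rightarrow> bool" where
  "agree n x z \<longleftrightarrow> (\<forall>j. \<bar>j\<bar> \<le> int n \<longrightarrow> x j = z j)"

lemma agree_refl [simp]: "agree n x x"
  and agree_trans: "agree n x z \<Longrightarrow> agree n z u \<Longrightarrow> agree n x u"
  and agree_mono: "agree n x z \<Longrightarrow> m \<le> n \<Longrightarrow> agree m x z"
  by (auto simp: agree_def)

lemma topspace_seq_topology [simp]: "topspace seq_topology = UNIV"
  by (simp add: seq_topology_def)

lemma openin_cylinder: "openin seq_topology {z. agree n x z}"
proof -
  have "{z. agree n x z} = Pi\<^sub>E UNIV (\<lambda>i. if \<bar>i\<bar> \<le> int n then {x i} else UNIV)"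
    by (auto simp: agree_def PiE_iff split: if_splits; metis)
  moreover have "finite {i. \<bar>i\<bar> \<le> int n}"
    by (rule finite_subset[of _ "{-int n..int n}"]) auto
  ultimately show ?thesis
    unfolding seq_topology_def
    by (auto simp: openin_PiE_gen elim: rev_finite_subset)
qed

text \<open>The cylinders \<open>{z. agree n x z}\<close> form a neighbourhood base, which turns
  every topological notion on sequence spaces into one about finite windows.\<close>

lemma openin_seq_iff:
  "openin seq_topology U \<longleftrightarrow> (\<forall>x\<in>U. \<exists>n. \<forall>z. agree n x z \<longrightarrow> z \<in> U)"
proof
  assume U: "openin seq_topology U"
  show "\<forall>x\<in>U. \<exists>n. \<forall>z. agree n x z \<longrightarrow> z \<in> U"
  proof
    fix x assume "x \<in> U"
    then obtain W where W: "finite {i. W i \<noteq> UNIV}" "x \<in> Pi\<^sub>E UNIV W" "Pi\<^sub>E UNIV W \<subseteq> U"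
      using U unfolding seq_topology_def openin_product_topology_alt by auto
    define n where "n = Max (insert 0 ((\<lambda>i. nat \<bar>i\<bar>) ` {i. W i \<noteq> UNIV}))"
    have n: "nat \<bar>i\<bar> \<le> n" if "W i \<noteq> UNIV" for i
      unfolding n_def using W(1) that by (intro Max_ge) auto
    have "z \<in> U" if z: "agree n x z" for z
    proof -
      have "z i \<in> W i" for i
      proof (cases "W i = UNIV")
        case False
        then have "x i = z i" using n[of i] z by (auto simp: agree_def)
        then show ?thesis using W(2) by (metis PiE_iff UNIV_I)
      qed auto
      then show ?thesis using W(3) by auto
    qed
    then show "\<exists>n. \<forall>z. agree n x z \<longrightarrow> z \<in> U" by blast
  qed
next
  assume r: "\<forall>x\<in>U. \<exists>n. \<forall>z. agree n x z \<longrightarrow> z \<in> U"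
  show "openin seq_topology U"
  proof (subst openin_subopen, intro ballI)
    fix x assume "x \<in> U"
    then obtain n where "\<forall>z. agree n x z \<longrightarrow> z \<in> U" using r by blast
    then show "\<exists>T. openin seq_topology T \<and> x \<in> T \<and> T \<subseteq> U"
      by (intro exI[of _ "{z. agree n x z}"]) (auto simp: openin_cylinder)
  qed
qed

lemma closedin_seq_iff:
  "closedin seq_topology X \<longleftrightarrow> (\<forall>z. (\<forall>n. \<exists>x\<in>X. agree n z x) \<longrightarrow> z \<in> X)"
  unfolding closedin_def openin_seq_iff topspace_seq_topology by (simp, blast)

lemma continuous_map_seq_iff:
  "continuous_map (subtopology seq_topology X) (subtopology seq_topology Y) f \<longleftrightarrow>
     f ` X \<subseteq> Y \<and> (\<forall>x\<in>X. \<forall>i. \<exists>n. \<forall>z\<in>X. agree n x z \<longrightarrow> f z i = f x i)"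
proof -
  have "continuous_map (subtopology seq_topology X) (discrete_topology UNIV) (\<lambda>x. f x i) \<longleftrightarrow>
     (\<forall>x\<in>X. \<exists>n. \<forall>z\<in>X. agree n x z \<longrightarrow> f z i = f x i)" (is "?L \<longleftrightarrow> ?R") for i
  proof
    assume c: ?L
    show ?R
    proof
      fix x assume x: "x \<in> X"
      have "openin (subtopology seq_topology X) {z \<in> X. f z i = f x i}"
        using openin_continuous_map_preimage[OF c, of "{f x i}"] by simp
      then obtain T where "openin seq_topology T" "{z \<in> X. f z i = f x i} = T \<inter> X"
        by (auto simp: openin_subtopology)
      then show "\<exists>n. \<forall>z\<in>X. agree n x z \<longrightarrow> f z i = f x i"
        using x unfolding openin_seq_iff by blast
    qed
  next
    assume r: ?R
    show ?L
      unfolding continuous_map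
    proof (intro conjI allI impI)
      fix U :: "'b set"
      have "openin (subtopology seq_topology X) {x \<in> X. f x i \<in> U}"
        unfolding openin_subtopology
      proof (intro exI conjI)
        define P where "P x n \<longleftrightarrow> x \<in> X \<and> f x i \<in> U \<and> (\<forall>z\<in>X. agree n x z \<longrightarrow> f z i = f x i)" for x n
        let ?T = "{z. \<exists>x n. P x n \<and> agree n x z}"
        show "openin seq_topology ?T"
          unfolding openin_seq_iff
        proof
          fix z assume "z \<in> ?T"
          then obtain x n where "P x n" "agree n x z" by blast
          then show "\<exists>n. \<forall>u. agree n z u \<longrightarrow> u \<in> ?T" using agree_trans by blast
        qed
        show "{x \<in> X. f x i \<in> U} = ?T \<inter> X"
        proof (intro equalityI subsetI)
          fix x assume x: "x \<in> {x \<in> X. f x i \<in> U}"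
          then obtain n where "P x n" using r unfolding P_def by blast
          then have "P x n \<and> agree n x x" by simp
          then show "x \<in> ?T \<inter> X" using x by (intro IntI CollectI exI[of _ x] exI[of _ n]) auto
        next
          fix z assume "z \<in> ?T \<inter> X"
          then obtain x n where "P x n" "agree n x z" "z \<in> X" by blast
          then have "f z i = f x i" "f x i \<in> U" unfolding P_def by blast+
          then show "z \<in> {x \<in> X. f x i \<in> U}" using \<open>z \<in> X\<close> by simp
        qed
      qed
      then show "openin (subtopology seq_topology X) {x \<in> topspace (subtopology seq_topology X). f x i \<in> U}"
        by simp
    qed auto
  qed
  then show ?thesis
    unfolding continuous_map_in_subtopology seq_topology_def[where 'a='b] continuous_map_componentwise_UNIV
    by (auto simp: image_subset_iff)
qed

lemma compactin_full_shift:
  assumes "finite C" shows "compactin seq_topology {x. range x \<subseteq> C}"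
proof -
  have eq: "{x. range x \<subseteq> C} = Pi\<^sub>E UNIV (\<lambda>_. C)" by (auto simp: PiE_iff)
  show ?thesis
    unfolding seq_topology_def eq using assms by (simp add: compactin_PiE compactin_discrete_topology)
qed

text \<open>The form in which compactness of the full shift is used throughout: on every window,
  \<open>z\<close> agrees with members of the sequence of arbitrarily large index.\<close>

lemma cluster_point:
  fixes f :: "nat \<Rightarrow> int \<Rightarrow> 'a"
  assumes "finite C" and f: "\<And>n. range (f n) \<subseteq> C"
  shows "\<exists>z. \<forall>n. \<exists>m\<ge>n. agree n z (f m)"
proof (rule ccontr)
    assume no: "\<nexists>z. \<forall>n. \<exists>m\<ge>n. agree n z (f m)"
    define V where "V n = {z. \<forall>m\<ge>n. \<not> agree n z (f m)}" for n
    have "openin seq_topology (V n)" for n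
      unfolding openin_seq_iff V_def using agree_trans by blast
    moreover have "{x. range x \<subseteq> C} \<subseteq> \<Union> (range V)" using no by (auto simp: V_def)
    ultimately obtain F where F: "finite F" "F \<subseteq> range V" "{x. range x \<subseteq> C} \<subseteq> \<Union>F"
      using compactin_full_shift[OF assms(1)] unfolding compactin_def
      by (metis (no_types, lifting) imageE)
    then obtain K where K: "finite K" "F = V ` K" by (metis finite_subset_image)
    obtain N where N: "\<forall>k\<in>K. k \<le> N"
      using K(1) finite_nat_set_iff_bounded_le by blast
    obtain k where "k \<in> K" "f N \<in> V k" using F(3) f K(2) by blast
    then show False using N by (auto simp: V_def)
  qed

lemma shift_pow_add [simp]: "shift_pow k (shift_pow l x) = shift_pow (k + l) x"
  by (auto simp: shift_pow_def add_ac)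

lemma shift_pow_0 [simp]: "shift_pow 0 x = x"
  by (simp add: shift_pow_def)

lemma shift_space_shift_pow:
  assumes "shift_space X" "x \<in> X" shows "shift_pow k x \<in> X"
proof -
  have s: "shift ` X = X" using assms(1) by (simp add: shift_space_def)
  have "shift_pow (int n) x \<in> X \<and> shift_pow (- int n) x \<in> X" for n
  proof (induction n)
    case (Suc n)
    have "shift (shift_pow (int n) x) \<in> X" using Suc s by blast
    moreover obtain z where z: "z \<in> X" "shift_pow (- int n) x = shift z" using Suc s by blast
    have "shift_pow (- 1) (shift_pow (- int n) x) = z" by (simp add: z)
    then have "shift_pow (- int (Suc n)) x = z" by simp
    ultimately show ?case using z(1) by (simp add: algebra_simps)
  qed (use assms in simp)
  then show ?thesis by (cases k rule: int_cases2) auto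
qed

lemma shift_spaceI:
  assumes "finite A" "\<And>x. x \<in> X \<Longrightarrow> range x \<subseteq> A"
    and "\<And>z. (\<And>n. \<exists>x\<in>X. agree n z x) \<Longrightarrow> z \<in> X"
    and sh: "\<And>x k. x \<in> X \<Longrightarrow> shift_pow k x \<in> X"
  shows "shift_space X"
proof -
  have "x \<in> shift ` X" if "x \<in> X" for x
    by (rule image_eqI[of _ _ "shift_pow (-1) x"]) (simp_all add: sh[OF that])
  moreover have "shift x \<in> X" if "x \<in> X" for x using sh[OF that] .
  ultimately have "shift ` X = X" by blast
  moreover have "X \<subseteq> {x. range x \<subseteq> A}" using assms(2) by auto
  moreover have "closedin seq_topology X" unfolding closedin_seq_iff using assms(3) by simp
  ultimately show ?thesis
    using assms(1) unfolding shift_space_def by (intro conjI exI[of _ A])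
qed

lemma shift_space_limit:
  "shift_space X \<Longrightarrow> (\<And>n. \<exists>x\<in>X. agree n z x) \<Longrightarrow> z \<in> X"
  unfolding shift_space_def closedin_seq_iff by blast

lemma shift_space_alphabet:
  "shift_space X \<Longrightarrow> \<exists>A. finite A \<and> (\<forall>x\<in>X. range x \<subseteq> A)"
  unfolding shift_space_def Ball_Collect by (elim conjE)

text \<open>Image symbols are read off a window of radius \<open>r\<close>. Comparing windows at
  different positions of different points builds shift-invariance into the notion.\<close>

definition block_code :: "nat \<Rightarrow> (int \<Rightarrow> 'a) set \<Rightarrow> ((int \<Rightarrow> 'a) \<Rightarrow> (int \<Rightarrow> 'b)) \<Rightarrow> bool" where
  "block_code r X \<phi> \<longleftrightarrow> (\<forall>x\<in>X. \<forall>x'\<in>X. \<forall>i i'.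
     (\<forall>k. \<bar>k\<bar> \<le> int r \<longrightarrow> x (i + k) = x' (i' + k)) \<longrightarrow> \<phi> x i = \<phi> x' i')"

lemma block_codeD:
  assumes "block_code r X \<phi>" "x \<in> X" "x' \<in> X" "\<And>k. \<bar>k\<bar> \<le> int r \<Longrightarrow> x (i + k) = x' (i' + k)"
  shows "\<phi> x i = \<phi> x' i'"
  using assms unfolding block_code_def by blast

lemma factor_code_shift_pow:
  assumes "factor_code \<phi> X Y" "x \<in> X" shows "\<phi> (shift_pow k x) = shift_pow k (\<phi> x)"
proof -
  have X: "shift_space X" using assms by (simp add: factor_code_def)
  have s: "\<phi> (shift z) = shift (\<phi> z)" if "z \<in> X" for z using assms that by (simp add: factor_code_def)
  have "\<phi> (shift_pow (int n) z) = shift_pow (int n) (\<phi> z)" if "z \<in> X" for n z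
  proof (induction n)
    case (Suc n)
    have "\<phi> (shift (shift_pow (int n) z)) = shift (\<phi> (shift_pow (int n) z))"
      using s shift_space_shift_pow[OF X that] by blast
    then show ?case using Suc by simp
  qed simp
  note p = this
  show ?thesis
  proof (cases k rule: int_cases2)
    case (nonpos n)
    have "\<phi> (shift_pow (int n) (shift_pow k x)) = shift_pow (int n) (\<phi> (shift_pow k x))"
      using p shift_space_shift_pow[OF X assms(2)] by blast
    then have "shift_pow k (\<phi> x) = shift_pow k (shift_pow (int n) (\<phi> (shift_pow k x)))"
      using nonpos by simp
    then show ?thesis using nonpos by simp
  qed (use p assms in simp)
qed

text \<open>The Curtis-Hedlund-Lyndon theorem. If no radius worked, a cluster point of a sequence
  of counterexamples would contradict continuity there.\<close>

lemma sliding_block: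
  assumes \<phi>: "factor_code \<phi> X Y"
  shows "\<exists>r. block_code r X \<phi>"
proof -
  have X: "shift_space X" using \<phi> by (simp add: factor_code_def)
  have "\<exists>r. \<forall>x\<in>X. \<forall>x'\<in>X. agree r x x' \<longrightarrow> \<phi> x 0 = \<phi> x' 0"
  proof (rule ccontr)
    assume "\<not> ?thesis"
    then have "\<forall>r. \<exists>x x'. x \<in> X \<and> x' \<in> X \<and> agree r x x' \<and> \<phi> x 0 \<noteq> \<phi> x' 0" by blast
    then obtain f g where fg: "\<And>r. f r \<in> X" "\<And>r. g r \<in> X" "\<And>r. agree r (f r) (g r)" "\<And>r. \<phi> (f r) 0 \<noteq> \<phi> (g r) 0"
      by metis
    obtain A where A: "finite A" "\<forall>x\<in>X. range x \<subseteq> A" using shift_space_alphabet[OF X] by blast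
    obtain z where z: "\<forall>n. \<exists>m\<ge>n. agree n z (f m)"
      using cluster_point[OF A(1) bspec[OF A(2) fg(1)]] ..
    have "z \<in> X" using z fg(1) by (intro shift_space_limit[OF X]) blast
    moreover have "continuous_map (subtopology seq_topology X) (subtopology seq_topology Y) \<phi>"
      using \<phi> by (simp add: factor_code_def)
    ultimately obtain n where n: "\<forall>x\<in>X. agree n z x \<longrightarrow> \<phi> x 0 = \<phi> z 0"
      unfolding continuous_map_seq_iff by blast
    obtain m where m: "m \<ge> n" "agree n z (f m)" using z by blast
    then have "agree n z (g m)" using agree_trans agree_mono[OF fg(3) m(1)] by metis
    then show False using n m fg by metis
  qed
  then obtain r where r: "\<And>x x'. x \<in> X \<Longrightarrow> x' \<in> X \<Longrightarrow> agree r x x' \<Longrightarrow> \<phi> x 0 = \<phi> x' 0" by blast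
  have "\<phi> x i = \<phi> x' i'"
    if a: "x \<in> X" "x' \<in> X" "\<forall>k. \<bar>k\<bar> \<le> int r \<longrightarrow> x (i + k) = x' (i' + k)" for x x' i i'
  proof -
    have "\<phi> (shift_pow i x) 0 = \<phi> (shift_pow i' x') 0"
      using a by (intro r shift_space_shift_pow[OF X]) (auto simp: agree_def shift_pow_def add_ac)
    then show "\<phi> x i = \<phi> x' i'"
      using a factor_code_shift_pow[OF \<phi>] by (simp add: shift_pow_def)
  qed
  then show ?thesis unfolding block_code_def by blast
qed

text \<open>The converse of \<open>sliding_block\<close>. The image is closed because a cluster
  point of preimages of approximations maps to the limit.\<close>

lemma factor_code_of_block_map:
  assumes X: "shift_space X" and B: "finite B" "\<And>x. x \<in> X \<Longrightarrow> range (\<phi> x) \<subseteq> B"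
    and r: "block_code r X \<phi>"
  shows "factor_code \<phi> X (\<phi> ` X)"
proof -
  have sh: "\<phi> (shift_pow k x) = shift_pow k (\<phi> x)" if "x \<in> X" for x k
  proof
    fix i show "\<phi> (shift_pow k x) i = shift_pow k (\<phi> x) i"
      unfolding shift_pow_def[of k "\<phi> x"]
      using that by (intro block_codeD[OF r] shift_space_shift_pow[OF X]) (auto simp: shift_pow_def add_ac)
  qed
  have loc: "\<phi> z i = \<phi> x i" if "x \<in> X" "z \<in> X" "agree (nat \<bar>i\<bar> + r) x z" for x z i
    using that by (intro block_codeD[OF r]) (auto simp: agree_def)
  have "shift_space (\<phi> ` X)"
  proof (rule shift_spaceI[OF B(1)])
    fix z assume z: "\<And>n. \<exists>x\<in>\<phi> ` X. agree n z x"
    have "\<forall>n. \<exists>x. x \<in> X \<and> agree n z (\<phi> x)" using z by fast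
    from choice[OF this] obtain f where f: "\<And>n. f n \<in> X" "\<And>n. agree n z (\<phi> (f n))" by auto
    obtain A where A: "finite A" "\<forall>x\<in>X. range x \<subseteq> A" using shift_space_alphabet[OF X] by blast
    obtain x where x: "\<forall>n. \<exists>m\<ge>n. agree n x (f m)"
      using cluster_point[OF A(1) bspec[OF A(2) f(1)]] ..
    have xX: "x \<in> X" using x f(1) by (intro shift_space_limit[OF X]) blast
    have "z i = \<phi> x i" for i
    proof -
      obtain m where m: "m \<ge> nat \<bar>i\<bar> + r" "agree (nat \<bar>i\<bar> + r) x (f m)" using x by blast
      then have "\<phi> (f m) i = \<phi> x i" by (intro loc xX f(1))
      moreover have "z i = \<phi> (f m) i" using f(2)[of m] m(1) by (auto simp: agree_def)
      ultimately show ?thesis by simp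
    qed
    then show "z \<in> \<phi> ` X" using xX by auto
  next
    fix x k assume "x \<in> \<phi> ` X" then show "shift_pow k x \<in> \<phi> ` X"
      using shift_space_shift_pow[OF X] sh by (metis imageE imageI)
  qed (use B in auto)
  then show ?thesis
    unfolding factor_code_def continuous_map_seq_iff using X sh loc by blast
qed

lemma words_iff:
  assumes "shift_space X"
  shows "w \<in> words X \<longleftrightarrow> (\<exists>x\<in>X. \<forall>k<length w. x (i + int k) = w ! k)"
proof
  assume "w \<in> words X"
  then obtain x j where x: "x \<in> X" "\<forall>k<length w. x (j + int k) = w ! k"
    by (auto simp: words_def occurs_in_def)
  then show "\<exists>x\<in>X. \<forall>k<length w. x (i + int k) = w ! k"
    using shift_space_shift_pow[OF assms x(1), of "j - i"]
    by (intro bexI[of _ "shift_pow (j - i) x"]) (auto simp: shift_pow_def algebra_simps)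
qed (auto simp: words_def occurs_in_def)

definition block :: "(int \<Rightarrow> 'a) \<Rightarrow> int \<Rightarrow> nat \<Rightarrow> 'a list" where
  "block x i n = map (\<lambda>k. x (i + int k)) [0..<n]"

lemma length_block [simp]: "length (block x i n) = n"
  and nth_block [simp]: "k < n \<Longrightarrow> block x i n ! k = x (i + int k)"
  by (simp_all add: block_def)

lemma block_eq_iff: "block x i n = u \<longleftrightarrow> length u = n \<and> (\<forall>k<n. x (i + int k) = u ! k)"
  by (auto simp: list_eq_iff_nth_eq)

lemma block_in_words: "x \<in> X \<Longrightarrow> block x i n \<in> words X"
  by (auto simp: words_def occurs_in_def)

lemma block_append: "block x i (m + n) = block x i m @ block x (i + int m) n"
  by (auto simp: list_eq_iff_nth_eq nth_append)

lemma block_shift_pow: "block (shift_pow k x) i n = block x (i + k) n"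
  by (auto simp: block_def shift_pow_def add_ac)

text \<open>Irreducibility in the shape used below: two windows of given points reappear in one
  point, separated by a gap.\<close>

lemma irreducible_connect:
  assumes X: "irreducible_shift X" and x: "x \<in> X" "x' \<in> X"
  obtains z l where "z \<in> X" "block z 0 m = block x i m"
    "block z (int (m + l)) n = block x' j n"
proof -
  let ?u = "block x i m" and ?v = "block x' j n"
  have "?u \<in> words X" "?v \<in> words X" using x by (auto intro: block_in_words)
  then obtain w where "?u @ w @ ?v \<in> words X" using X unfolding irreducible_shift_def by blast
  moreover have ss: "shift_space X" using X by (simp add: irreducible_shift_def)
  ultimately have "\<exists>z\<in>X. \<forall>k<length (?u @ w @ ?v). z (0 + int k) = (?u @ w @ ?v) ! k"
    by (simp only: words_iff[OF ss, of _ 0])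
  then obtain z where z: "z \<in> X" "\<forall>k<length (?u @ w @ ?v). z (0 + int k) = (?u @ w @ ?v) ! k"
    by (elim bexE)
  then have "block z 0 (m + length w + n) = ?u @ w @ ?v"
    by (intro iffD2[OF block_eq_iff] conjI) simp_all
  then have "block z 0 m @ block z (int m) (length w) @ block z (int (m + length w)) n = ?u @ w @ ?v"
    by (simp only: block_append append_assoc add_0 of_nat_add)
  then have "block z 0 m = ?u" "block z (int (m + length w)) n = ?v"
    by (auto simp: append_eq_append_conv)
  then show ?thesis by (rule that[OF z(1)])
qed

text \<open>Words of the image come from longer words of \<open>X\<close>, widened by the coding
  radius on both sides. A point of \<open>X\<close> containing both of these has an image
  containing both words.\<close>

lemma irreducible_factor:
  assumes X: "irreducible_shift X" and \<phi>: "factor_code \<phi> X Y"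
  shows "irreducible_shift Y"
  unfolding irreducible_shift_def
proof (intro conjI ballI)
  show Y: "shift_space Y" using \<phi> by (simp add: factor_code_def)
  obtain r where r: "block_code r X \<phi>" using sliding_block[OF \<phi>] by blast
  have blk: "block (\<phi> x) (p + int r) l = block (\<phi> x') (p' + int r) l"
    if b: "block x p (l + 2 * r) = block x' p' (l + 2 * r)" and "x \<in> X" "x' \<in> X" for x x' p p' l
  proof -
    have e: "x (p + k) = x' (p' + k)" if "0 \<le> k" "k < int (l + 2 * r)" for k
    proof -
      have "nat k < l + 2 * r" "int (nat k) = k" using that by auto
      then show ?thesis using arg_cong[OF b, of "\<lambda>b. b ! nat k"] by simp
    qed
    have "\<phi> x (p + int r + int k) = \<phi> x' (p' + int r + int k)" if "k < l" for k
    proof (rule block_codeD[OF r \<open>x \<in> X\<close> \<open>x' \<in> X\<close>])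
      fix q assume "\<bar>q\<bar> \<le> int r"
      then show "x (p + int r + int k + q) = x' (p' + int r + int k + q)"
        using e[of "int r + int k + q"] that by (simp add: add.assoc)
    qed
    then show ?thesis by (simp add: block_eq_iff)
  qed
  fix u v assume "u \<in> words Y" "v \<in> words Y"
  then obtain x x' where x: "x \<in> X" "x' \<in> X" "block (\<phi> x) 0 (length u) = u" "block (\<phi> x') 0 (length v) = v"
    using \<phi> unfolding words_iff[OF Y, of _ 0] by (auto simp: factor_code_def block_eq_iff)
  obtain z l where z: "z \<in> X" "block z 0 (length u + 2 * r) = block x (- int r) (length u + 2 * r)"
    "block z (int (length u + 2 * r + l)) (length v + 2 * r) = block x' (- int r) (length v + 2 * r)"
    by (rule irreducible_connect[OF X x(1,2)])
  have "block (\<phi> z) (0 + int r) (length u) = u"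
    using blk[OF z(2) z(1) x(1)] x(3) by simp
  moreover have "block (\<phi> z) (int (length u + 2 * r + l) + int r) (length v) = v"
    using blk[OF z(3) z(1) x(2)] x(4) by simp
  moreover have "int (length u + 2 * r + l) + int r = int r + int (length u) + int (2 * r + l)"
    by simp
  ultimately have "u @ block (\<phi> z) (int r + int (length u)) (2 * r + l) @ v
      = block (\<phi> z) (int r) (length u + ((2 * r + l) + length v))"
    by (simp only: block_append add_0)
  moreover have "\<phi> z \<in> Y" using \<phi> z(1) by (auto simp: factor_code_def)
  ultimately show "\<exists>w\<in>words Y. u @ w @ v \<in> words Y" by (metis block_in_words)
qed

section \<open>Shifts of finite type and sofic shifts\<close>

lemma block_code_mono:
  assumes "block_code r X \<phi>" "r \<le> r'" shows "block_code r' X \<phi>"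
  unfolding block_code_def
  by (intro ballI allI impI block_codeD[OF assms(1)]) (use assms(2) in auto)

text \<open>The Markov property of an SFT: a forbidden word in the spliced point is no longer than
  the overlap, so it already occurs in one of the two given points.\<close>

lemma sft_splice:
  assumes "sft X"
  shows "\<exists>M. \<forall>N\<ge>M. \<forall>x\<in>X. \<forall>x'\<in>X. \<forall>i. (\<forall>k. \<bar>k\<bar> \<le> int N \<longrightarrow> x (i + k) = x' (i + k)) \<longrightarrow>
    (\<lambda>j. if j \<le> i then x j else x' j) \<in> X"
proof -
  obtain A F where F: "finite F" and X: "X = {x. range x \<subseteq> A \<and> (\<forall>v\<in>F. \<not> occurs_in v x)}"
    using assms unfolding sft_def by blast
  define M where "M = Max (insert 0 (length ` F))"
  have M: "\<forall>v\<in>F. length v \<le> M" using F by (simp add: M_def)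
  have "(\<lambda>j. if j \<le> i then x j else x' j) \<in> X"
    if N: "N \<ge> M" and x: "x \<in> X" "x' \<in> X" and eq: "\<forall>k. \<bar>k\<bar> \<le> int N \<longrightarrow> x (i + k) = x' (i + k)" for N x x' i
  proof -
    define z where "z = (\<lambda>j. if j \<le> i then x j else x' j)"
    have l: "z j = x j" if "j \<le> i + int N" for j
      using eq[rule_format, of "j - i"] that by (simp add: z_def)
    have "range z \<subseteq> A" using x unfolding X z_def by auto
    moreover have "\<not> occurs_in v z" if v: "v \<in> F" for v
    proof
      assume "occurs_in v z"
      then obtain p where p: "\<forall>k<length v. z (p + int k) = v ! k" unfolding occurs_in_def by blast
      have len: "length v \<le> N" using M v N by fastforce
      show False
      proof (cases "p + int (length v) \<le> i + int N + 1")
        case True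
        then have "\<forall>k<length v. x (p + int k) = v ! k" using p l by simp
        then have "occurs_in v x" unfolding occurs_in_def by blast
        then show False using x(1) v unfolding X by blast
      next
        case False
        then have "p > i" using len by linarith
        then have "\<forall>k<length v. x' (p + int k) = v ! k" using p by (simp add: z_def)
        then have "occurs_in v x'" unfolding occurs_in_def by blast
        then show False using x(2) v unfolding X by blast
      qed
    qed
    ultimately show ?thesis unfolding X z_def by blast
  qed
  then show ?thesis by (intro exI[of _ M]) simp
qed

text \<open>The definition of soficity asks for a covering SFT over the natural numbers, so the
  alphabet of \<open>X\<close> is renamed injectively.\<close>

lemma sofic_factor:
  fixes X :: "(int \<Rightarrow> 'a) set"
  assumes sft: "sft X" and \<phi>: "factor_code \<phi> X Y"
  shows "sofic Y"
proof -
  have ssX: "shift_space X" using \<phi> by (simp add: factor_code_def)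
  obtain A F where A: "finite A" and F: "finite F" "F \<subseteq> lists A"
    and X: "X = {x. range x \<subseteq> A \<and> (\<forall>v\<in>F. \<not> occurs_in v x)}"
    using sft unfolding sft_def by blast
  obtain f :: "'a \<Rightarrow> nat" where f: "inj_on f A" using finite_imp_inj_to_nat_seg[OF A] by blast
  define g where "g = inv_into A f"
  have gf: "g (f a) = a" if "a \<in> A" for a using that f by (simp add: g_def)
  have fg: "f (g n) = n" "g n \<in> A" if "n \<in> f ` A" for n
    using that unfolding g_def by (rule f_inv_into_f, rule inv_into_into)
  define Z where "Z = (\<lambda>x. f \<circ> x) ` X"
  have XA: "x i \<in> A" if "x \<in> X" for x i using that unfolding X by auto
  have gZ: "g \<circ> (f \<circ> x) = x" if "x \<in> X" for x using XA[OF that] gf by (simp add: fun_eq_iff)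
  have "Z = {z. range z \<subseteq> f ` A \<and> (\<forall>v\<in>map f ` F. \<not> occurs_in v z)}"
  proof (intro equalityI subsetI)
    fix z assume "z \<in> Z"
    then obtain x where x: "x \<in> X" "z = f \<circ> x" unfolding Z_def by blast
    then have "range z \<subseteq> f ` A" using XA by auto
    moreover have "\<forall>v\<in>map f ` F. \<not> occurs_in v z"
    proof (intro ballI notI)
      fix v assume "v \<in> map f ` F" "occurs_in v z"
      then obtain u p where u: "u \<in> F" "\<forall>k<length u. f (x (p + int k)) = f (u ! k)"
        unfolding x(2) occurs_in_def by auto
      have "x (p + int k) = u ! k" if "k < length u" for k
      proof (rule inj_onD[OF f])
        show "f (x (p + int k)) = f (u ! k)" using u(2) that by simp
        show "x (p + int k) \<in> A" by (rule XA[OF x(1)])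
        show "u ! k \<in> A" using F(2) u(1) that by (meson in_lists_conv_set nth_mem subsetD)
      qed
      then have "occurs_in u x" unfolding occurs_in_def by blast
      then show False using x(1) u(1) unfolding X by blast
    qed
    ultimately show "z \<in> {z. range z \<subseteq> f ` A \<and> (\<forall>v\<in>map f ` F. \<not> occurs_in v z)}" by simp
  next
    fix z assume z: "z \<in> {z. range z \<subseteq> f ` A \<and> (\<forall>v\<in>map f ` F. \<not> occurs_in v z)}"
    then have zA: "z i \<in> f ` A" for i by auto
    have "f \<circ> (g \<circ> z) = z" using fg(1)[OF zA] by (simp add: fun_eq_iff)
    moreover have "g \<circ> z \<in> X"
      unfolding X
    proof (intro CollectI conjI ballI notI)
      show "range (g \<circ> z) \<subseteq> A" using fg(2)[OF zA] by auto
      fix v assume v: "v \<in> F" "occurs_in v (g \<circ> z)"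
      then obtain p where "\<forall>k<length v. g (z (p + int k)) = v ! k" unfolding occurs_in_def by auto
      then have "f (g (z (p + int k))) = f (v ! k)" if "k < length v" for k using that by simp
      then have "\<forall>k<length (map f v). z (p + int k) = map f v ! k" using fg(1)[OF zA] by simp
      then have "occurs_in (map f v) z" unfolding occurs_in_def by blast
      then show False using z v(1) by blast
    qed
    ultimately show "z \<in> Z" unfolding Z_def by (metis image_eqI)
  qed
  moreover have "map f ` F \<subseteq> lists (f ` A)"
    using F(2) by (auto simp: in_lists_conv_set subset_iff)
  ultimately have sftZ: "sft Z"
    unfolding sft_def using A F(1) by (intro exI[of _ "f ` A"] exI[of _ "map f ` F"] conjI) simp_all
  have "factor_code (\<lambda>x. f \<circ> x) X Z"
    unfolding Z_def
  proof (rule factor_code_of_block_map[OF ssX, of "f ` A" _ 0])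
    show "block_code 0 X (\<lambda>x. f \<circ> x)" unfolding block_code_def by simp
  qed (use A XA in auto)
  then have ssZ: "shift_space Z" by (simp add: factor_code_def)
  obtain r where r: "block_code r X \<phi>" using sliding_block[OF \<phi>] by blast
  have ZX: "g \<circ> z \<in> X" if "z \<in> Z" for z using that gZ unfolding Z_def by auto
  have im: "(\<lambda>z. \<phi> (g \<circ> z)) ` Z = Y"
    using \<phi> gZ unfolding Z_def factor_code_def by (simp add: image_image)
  have ssY: "shift_space Y" using \<phi> by (simp add: factor_code_def)
  obtain B where B: "finite B" "\<forall>y\<in>Y. range y \<subseteq> B" using shift_space_alphabet[OF ssY] by blast
  have "factor_code (\<lambda>z. \<phi> (g \<circ> z)) Z ((\<lambda>z. \<phi> (g \<circ> z)) ` Z)"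
  proof (rule factor_code_of_block_map[OF ssZ B(1)])
    show "range (\<phi> (g \<circ> z)) \<subseteq> B" if "z \<in> Z" for z using B(2) im that by blast
    show "block_code r Z (\<lambda>z. \<phi> (g \<circ> z))"
      unfolding block_code_def by (intro ballI allI impI block_codeD[OF r ZX ZX]) simp_all
  qed
  then show ?thesis unfolding sofic_def im using sftZ by blast
qed

section \<open>Doubly transitive points\<close>

lemma word_block_at:
  assumes "shift_space Y" "v \<in> words Y" shows "\<exists>z\<in>Y. block z i (length v) = v"
  using assms words_iff[OF assms(1), of v i] by (auto simp: block_eq_iff)

lemma block_eq_agree:
  assumes "block x (p - int M) (2 * M + 1) = block z (- int M) (2 * M + 1)"
  shows "agree M z (shift_pow p x)"
  unfolding agree_def
proof (intro allI impI)
  fix j assume "\<bar>j\<bar> \<le> int M"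
  then have "nat (j + int M) < 2 * M + 1" "int (nat (j + int M)) = j + int M" by auto
  then show "z j = shift_pow p x j"
    using arg_cong[OF assms, of "\<lambda>l. l ! nat (j + int M)"] by (simp add: shift_pow_def algebra_simps)
qed

text \<open>Cylinders are a base, so density can be tested on them.\<close>

lemma closure_of_cylinder_iff:
  "subtopology seq_topology Y closure_of R = Y \<longleftrightarrow> (\<forall>z\<in>Y. \<forall>M. \<exists>u\<in>R \<inter> Y. agree M z u)"
proof -
  have "z \<in> subtopology seq_topology Y closure_of R \<longleftrightarrow> z \<in> Y \<and> (\<forall>M. \<exists>u\<in>R \<inter> Y. agree M z u)" for z
  proof
    assume z: "z \<in> subtopology seq_topology Y closure_of R"
    then have zY: "z \<in> Y" by (simp add: in_closure_of)
    have "\<exists>u\<in>R \<inter> Y. agree M z u" for M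
    proof -
      have "openin (subtopology seq_topology Y) ({u. agree M z u} \<inter> Y)"
        using openin_cylinder by (auto simp: openin_subtopology)
      then have "\<exists>u. u \<in> R \<and> u \<in> {u. agree M z u} \<inter> Y"
        using z zY unfolding in_closure_of by (metis (no_types, lifting) IntI agree_refl mem_Collect_eq)
      then show ?thesis by blast
    qed
    then show "z \<in> Y \<and> (\<forall>M. \<exists>u\<in>R \<inter> Y. agree M z u)" using zY by blast
  next
    assume r: "z \<in> Y \<and> (\<forall>M. \<exists>u\<in>R \<inter> Y. agree M z u)"
    have "\<exists>u. u \<in> R \<and> u \<in> W" if W: "z \<in> W" "openin (subtopology seq_topology Y) W" for W
    proof -
      obtain V where V: "openin seq_topology V" "W = V \<inter> Y" using W(2) by (auto simp: openin_subtopology)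
      then obtain M where M: "\<forall>u. agree M z u \<longrightarrow> u \<in> V" using W(1) unfolding openin_seq_iff by blast
      obtain u where "u \<in> R \<inter> Y" "agree M z u" using r by blast
      then show ?thesis using M V(2) by blast
    qed
    then show "z \<in> subtopology seq_topology Y closure_of R" using r by (simp add: in_closure_of)
  qed
  then show ?thesis by blast
qed

text \<open>Up to a shift a cylinder is a word: the orbit visits the cylinder of \<open>v\<close>
  placed at \<open>n\<close> at time \<open>m\<close> iff \<open>v\<close> occurs at \<open>n +
  m\<close>. Placing the cylinder far away gives occurrences far away.\<close>

lemma doubly_transitive_iff:
  assumes Y: "shift_space Y"
  shows "doubly_transitive Y y \<longleftrightarrow> y \<in> Y \<and>
    (\<forall>v\<in>words Y. \<forall>n. (\<exists>i\<ge>n. block y i (length v) = v) \<and> (\<exists>i\<le>n. block y i (length v) = v))"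
    (is "_ \<longleftrightarrow> _ \<and> ?w_at")
proof (cases "y \<in> Y")
  case True
  note sh = shift_space_shift_pow[OF Y True]
  have occ_shift: "block y (i + p) l = v"
    if "agree (nat \<bar>i\<bar> + l) z (shift_pow p y)" "block z i l = v" for z i l p v
  proof -
    have "y (i + p + int k) = z (i + int k)" if "k < l" for k
      using \<open>agree _ _ _\<close> that by (auto simp: agree_def shift_pow_def add_ac)
    then show ?thesis using that(2) by (simp add: block_eq_iff)
  qed
  have orb: "(\<exists>u\<in>range (\<lambda>n. shift_pow (g n) y) \<inter> Y. agree M z u) \<longleftrightarrow> (\<exists>n. agree M z (shift_pow (g n) y))"
    for g :: "nat \<Rightarrow> int" and M z
  proof
    assume "\<exists>n. agree M z (shift_pow (g n) y)"
    then obtain n where "agree M z (shift_pow (g n) y)" ..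
    then show "\<exists>u\<in>range (\<lambda>n. shift_pow (g n) y) \<inter> Y. agree M z u"
      by (intro bexI[of _ "shift_pow (g n) y"]) (simp_all add: sh)
  qed auto
  have "doubly_transitive Y y \<longleftrightarrow> (\<forall>z\<in>Y. \<forall>M. (\<exists>n. agree M z (shift_pow (int n) y)) \<and> (\<exists>n. agree M z (shift_pow (- int n) y)))"
    unfolding doubly_transitive_def closure_of_cylinder_iff orb using True by blast
  also have "\<dots> \<longleftrightarrow> ?w_at"
  proof
    assume d: "\<forall>z\<in>Y. \<forall>M. (\<exists>n. agree M z (shift_pow (int n) y)) \<and> (\<exists>n. agree M z (shift_pow (- int n) y))"
    show ?w_at
    proof (intro ballI allI)
      fix v n assume "v \<in> words Y"
      then obtain z where z: "z \<in> Y" "block z n (length v) = v" using word_block_at[OF Y] by blast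
      obtain m m' where "agree (nat \<bar>n\<bar> + length v) z (shift_pow (int m) y)"
        "agree (nat \<bar>n\<bar> + length v) z (shift_pow (- int m') y)" using d z(1) by blast
      then have "block y (n + int m) (length v) = v" "block y (n + - int m') (length v) = v"
        using occ_shift z(2) by blast+
      then show "(\<exists>i\<ge>n. block y i (length v) = v) \<and> (\<exists>i\<le>n. block y i (length v) = v)"
        by (intro conjI exI[of _ "n + int m"] exI[of _ "n + - int m'"]) simp_all
    qed
  next
    assume o: ?w_at
    show "\<forall>z\<in>Y. \<forall>M. (\<exists>n. agree M z (shift_pow (int n) y)) \<and> (\<exists>n. agree M z (shift_pow (- int n) y))"
    proof (intro ballI allI)
      fix z M assume "z \<in> Y"
      then have "block z (- int M) (2 * M + 1) \<in> words Y" by (rule block_in_words)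
      with o have o': "(\<exists>i\<ge>- int M. block y i (2 * M + 1) = block z (- int M) (2 * M + 1)) \<and>
         (\<exists>i\<le>- int M. block y i (2 * M + 1) = block z (- int M) (2 * M + 1))" by fastforce
      from o' obtain i where i: "i \<ge> - int M" "block y i (2 * M + 1) = block z (- int M) (2 * M + 1)" by blast
      from o' obtain i' where i': "i' \<le> - int M" "block y i' (2 * M + 1) = block z (- int M) (2 * M + 1)" by blast
      have "agree M z (shift_pow (int (nat (i + int M))) y)" by (rule block_eq_agree) (use i in simp)
      moreover have "agree M z (shift_pow (- int (nat (- (i' + int M)))) y)" by (rule block_eq_agree) (use i' in simp)
      ultimately show "(\<exists>n. agree M z (shift_pow (int n) y)) \<and> (\<exists>n. agree M z (shift_pow (- int n) y))" by blast
    qed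
  qed
  finally show ?thesis using True by simp
qed (simp add: doubly_transitive_def)

lemma compact_space_shift_space:
  assumes "shift_space Y" shows "compact_space (subtopology seq_topology Y)"
proof -
  obtain A where A: "finite A" "\<forall>x\<in>Y. range x \<subseteq> A" using shift_space_alphabet[OF assms] by blast
  have "compactin seq_topology Y"
  proof (rule closed_compactin[OF compactin_full_shift[OF A(1)]])
    show "Y \<subseteq> {x. range x \<subseteq> A}" using A(2) by (simp add: Ball_Collect)
    show "closedin seq_topology Y" using assms by (simp add: shift_space_def)
  qed
  then show ?thesis by (rule compact_space_subtopology)
qed

lemma openin_occurrence:
  "openin (subtopology seq_topology Y) {z \<in> Y. \<exists>i. P i \<and> block z i (length v) = v}"
proof -
  have "openin seq_topology {z. \<exists>i. P i \<and> block z i (length v) = v}"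
    unfolding openin_seq_iff
  proof (intro ballI)
    fix x assume "x \<in> {z. \<exists>i. P i \<and> block z i (length v) = v}"
    then obtain i where i: "P i" "block x i (length v) = v" by blast
    have "block z i (length v) = v" if "agree (nat \<bar>i\<bar> + length v) x z" for z
    proof -
      have "block z i (length v) = block x i (length v)"
        using that by (intro nth_equalityI) (auto simp: agree_def)
      then show ?thesis using i(2) by simp
    qed
    then show "\<exists>n. \<forall>z. agree n x z \<longrightarrow> z \<in> {z. \<exists>i. P i \<and> block z i (length v) = v}" using i(1) by blast
  qed
  then have "openin (subtopology seq_topology Y) ({z. \<exists>i. P i \<and> block z i (length v) = v} \<inter> Y)"
    by (rule openin_subtopology_Int)
  moreover have "{z \<in> Y. \<exists>i. P i \<and> block z i (length v) = v} = {z. \<exists>i. P i \<and> block z i (length v) = v} \<inter> Y" by blast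
  ultimately show ?thesis by simp
qed

text \<open>Density of the two families of open sets whose intersection consists of the doubly
  transitive points. The given window is prolonged by \<open>\<bar>n\<bar>\<close> symbols towards
  the side of the new occurrence, so that this occurrence lies beyond \<open>n\<close>.\<close>

lemma word_far_away:
  assumes Y: "irreducible_shift Y" and z: "z \<in> Y" and v: "v \<in> words Y"
  shows "\<exists>u\<in>Y. agree M z u \<and> (\<exists>i\<ge>n. block u i (length v) = v)"
    and "\<exists>u\<in>Y. agree M z u \<and> (\<exists>i\<le>n. block u i (length v) = v)"
proof -
  have ss: "shift_space Y" using Y by (simp add: irreducible_shift_def)
  obtain z' where z': "z' \<in> Y" "block z' 0 (length v) = v" using word_block_at[OF ss v] by blast
  define K where "K = nat \<bar>n\<bar>"
  obtain x l where x: "x \<in> Y" "block x 0 (2 * M + 1 + K) = block z (- int M) (2 * M + 1 + K)"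
    "block x (int (2 * M + 1 + K + l)) (length v) = block z' 0 (length v)"
    by (rule irreducible_connect[OF Y z z'(1)])
  have "block x 0 (2 * M + 1) = block z (- int M) (2 * M + 1)"
    using x(2) unfolding block_append[of _ _ "2 * M + 1" K] by simp
  then have "agree M z (shift_pow (int M) x)" by (intro block_eq_agree) simp
  moreover have "block (shift_pow (int M) x) (int (2 * M + 1 + K + l) - int M) (length v) = v"
    using x(3) z'(2) by (simp add: block_shift_pow add_ac)
  moreover have "int (2 * M + 1 + K + l) - int M \<ge> n" by (simp add: K_def)
  ultimately show "\<exists>u\<in>Y. agree M z u \<and> (\<exists>i\<ge>n. block u i (length v) = v)"
    using shift_space_shift_pow[OF ss x(1)] by blast
  obtain x l where x: "x \<in> Y" "block x 0 (length v) = block z' 0 (length v)"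
    "block x (int (length v + l)) (K + (2 * M + 1)) = block z (- int M - int K) (K + (2 * M + 1))"
    by (rule irreducible_connect[OF Y z'(1) z])
  have "block x (int (length v + l) + int K) (2 * M + 1) = block z (- int M - int K + int K) (2 * M + 1)"
    using x(3) unfolding block_append[of _ _ K "2 * M + 1"] by simp
  then have "agree M z (shift_pow (int (length v + l) + int K + int M) x)" by (intro block_eq_agree) simp
  moreover have "block (shift_pow (int (length v + l) + int K + int M) x) (- (int (length v + l) + int K + int M)) (length v) = v"
    using x(2) z'(2) by (simp add: block_shift_pow)
  moreover have "- (int (length v + l) + int K + int M) \<le> n" by (simp add: K_def)
  ultimately show "\<exists>u\<in>Y. agree M z u \<and> (\<exists>i\<le>n. block u i (length v) = v)"
    using shift_space_shift_pow[OF ss x(1)] by blast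
qed

text \<open>Baire's theorem for the compact Hausdorff space \<open>Y\<close>; there are only
  countably many conditions because there are only countably many words.\<close>

lemma doubly_transitive_exists:
  assumes Y: "irreducible_shift Y" and ne: "Y \<noteq> {}"
  shows "\<exists>y. doubly_transitive Y y"
proof -
  have ss: "shift_space Y" using Y by (simp add: irreducible_shift_def)
  define U where "U v n = {z \<in> Y. \<exists>i. i \<ge> n \<and> block z i (length v) = v}" for v :: "'a list" and n
  define V where "V v n = {z \<in> Y. \<exists>i. i \<le> n \<and> block z i (length v) = v}" for v :: "'a list" and n
  let ?G = "(\<lambda>(v, n). U v n) ` (words Y \<times> UNIV) \<union> (\<lambda>(v, n). V v n) ` (words Y \<times> UNIV)"
  let ?t = "subtopology seq_topology Y"
  obtain A where A: "finite A" "\<forall>x\<in>Y. range x \<subseteq> A" using shift_space_alphabet[OF ss] by blast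
  have "words Y \<subseteq> lists A"
  proof
    fix v assume "v \<in> words Y"
    then obtain z where z: "z \<in> Y" "block z 0 (length v) = v" using word_block_at[OF ss] by blast
    have "set (block z 0 (length v)) \<subseteq> A" using A(2) z(1) by (auto simp: block_def image_subset_iff)
    then show "v \<in> lists A" using z(2) by auto
  qed
  then have "countable (words Y)" using A(1) countable_finite countable_lists countable_subset by metis
  then have "countable ?G" by (intro countable_Un countable_image countable_SIGMA) auto
  moreover have "compact_space ?t" by (rule compact_space_shift_space[OF ss])
  moreover have "Hausdorff_space ?t"
    by (intro Hausdorff_space_subtopology) (simp add: seq_topology_def Hausdorff_space_product_topology)
  ultimately have "locally_compact_space ?t \<and> regular_space ?t"
    by (simp add: compact_imp_locally_compact_space compact_Hausdorff_imp_regular_space)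
  moreover have "openin ?t W \<and> ?t closure_of W = topspace ?t" if "W \<in> ?G" for W
  proof -
    have dense: "?t closure_of W = Y" if "\<And>z M. z \<in> Y \<Longrightarrow> \<exists>u\<in>Y. agree M z u \<and> u \<in> W" for W
      unfolding closure_of_cylinder_iff using that by blast
    from \<open>W \<in> ?G\<close> consider v n where "v \<in> words Y" "W = U v n" | v n where "v \<in> words Y" "W = V v n" by auto
    then show ?thesis
    proof cases
      case 1
      have "?t closure_of W = Y"
      proof (rule dense)
        fix z M assume "z \<in> Y"
        from word_far_away(1)[OF Y this 1(1), of M n] show "\<exists>u\<in>Y. agree M z u \<and> u \<in> W"
          unfolding 1(2) U_def by blast
      qed
      then show ?thesis unfolding 1(2) U_def by (simp add: openin_occurrence)
    next
      case 2
      have "?t closure_of W = Y"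
      proof (rule dense)
        fix z M assume "z \<in> Y"
        from word_far_away(2)[OF Y this 2(1), of M n] show "\<exists>u\<in>Y. agree M z u \<and> u \<in> W"
          unfolding 2(2) V_def by blast
      qed
      then show ?thesis unfolding 2(2) V_def by (simp add: openin_occurrence)
    qed
  qed
  ultimately have cl: "?t closure_of \<Inter>?G = topspace ?t"
    using \<open>countable ?G\<close> by (intro Baire_category) auto
  have "\<Inter>?G \<inter> Y \<noteq> {}"
  proof -
    obtain z where "z \<in> Y" using ne by blast
    moreover have "?t closure_of \<Inter>?G = Y" using cl by simp
    ultimately show ?thesis unfolding closure_of_cylinder_iff by blast
  qed
  then obtain y where "y \<in> Y" "y \<in> \<Inter>?G" by blast
  have "y \<in> U v n \<and> y \<in> V v n" if "v \<in> words Y" for v n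
  proof -
    have "U v n \<in> ?G" "V v n \<in> ?G" using that by auto
    then show ?thesis using \<open>y \<in> \<Inter>?G\<close> by (meson InterD)
  qed
  then have "doubly_transitive Y y"
    unfolding doubly_transitive_iff[OF ss] U_def V_def using \<open>y \<in> Y\<close> by simp
  then show ?thesis by (intro exI[of _ y])
qed

section \<open>Irreducible finite semigroups of relations\<close>

text \<open>A power with exponent a multiple of the eventual period and beyond the preperiod is
  idempotent. Successors are used because the zeroth power is the identity on the whole type, not
  on \<open>S\<close>.\<close>

lemma idempotent_power:
  fixes r :: "('s \<times> 's) set"
  assumes "finite S" "r \<subseteq> S \<times> S"
  shows "\<exists>m. r ^^ Suc m O r ^^ Suc m = r ^^ Suc m"
proof -
  have "range (\<lambda>n. r ^^ Suc n) \<subseteq> Pow (S \<times> S)"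
  proof clarify
    fix n s t assume "(s, t) \<in> r ^^ Suc n"
    then show "s \<in> S \<and> t \<in> S"
      using assms(2) by (metis SigmaE2 relpow_Suc_D2 relpow_Suc_E subsetD)
  qed
  then have "finite (range (\<lambda>n. r ^^ Suc n))"
    using assms(1) by (meson finite_Pow_iff finite_SigmaI finite_subset)
  then have ninj: "\<not> inj (\<lambda>n. r ^^ Suc n)" using finite_imageD infinite_UNIV_nat by blast
  have "\<exists>i j. i < j \<and> r ^^ Suc i = r ^^ Suc j"
  proof (rule ccontr)
    assume "\<not> ?thesis"
    then have "inj (\<lambda>n. r ^^ Suc n)" by (intro linorder_injI) blast
    then show False using ninj by blast
  qed
  then obtain i j where ij: "i < j" "r ^^ Suc i = r ^^ Suc j" by blast
  from less_imp_add_positive[OF ij(1)] obtain p where "p > 0" "i + p = j" by blast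
  have "Suc j = Suc i + p" using \<open>i + p = j\<close> by simp
  from ij(2)[unfolded this] have p: "r ^^ Suc i = r ^^ (Suc i + p)" .
  have step: "r ^^ (n + p) = r ^^ n" if "n \<ge> Suc i" for n
  proof -
    define k where "k = n - Suc i"
    have "n = k + Suc i" using that by (simp add: k_def)
    have "r ^^ (n + p) = r ^^ k O r ^^ (Suc i + p)" unfolding \<open>n = k + Suc i\<close> add.assoc by (rule relpow_add)
    also have "\<dots> = r ^^ n" unfolding p[symmetric] \<open>n = k + Suc i\<close> by (rule relpow_add[symmetric])
    finally show ?thesis .
  qed
  have steps: "r ^^ (n + k * p) = r ^^ n" if "n \<ge> Suc i" for n k
  proof (induction k)
    case (Suc k)
    have "r ^^ (n + Suc k * p) = r ^^ ((n + k * p) + p)" by (simp add: algebra_simps)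
    also have "\<dots> = r ^^ (n + k * p)" by (rule step) (use that in simp)
    finally show ?case using Suc by simp
  qed simp
  \<comment> \<open>a multiple of the period \<open>p\<close> that lies beyond the preperiod\<close>
  define m where "m = Suc i * p"
  have "Suc i * 1 \<le> m" unfolding m_def using \<open>p > 0\<close> by (intro mult_le_mono2) simp
  then have "m \<ge> Suc i" by simp
  then have "r ^^ m O r ^^ m = r ^^ m"
    using steps[of m "Suc i"] by (simp only: m_def[symmetric] relpow_add)
  moreover obtain m' where "m = Suc m'" using \<open>m \<ge> Suc i\<close> by (metis Suc_le_D)
  ultimately show ?thesis by blast
qed

text \<open>A pair in an idempotent relation factors again and again, so in the finite case it
  passes through a recurrent element. Among the elements between \<open>s\<close> and
  \<open>t\<close>, let \<open>a\<close> have the fewest successors; then a successor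
  \<open>b\<close> of \<open>a\<close> that still reaches \<open>t\<close> cannot have fewer and
  is a successor of itself.\<close>

lemma idempotent_middle:
  assumes "finite S" "e \<subseteq> S \<times> S" "e O e = e" "(s, t) \<in> e"
  shows "\<exists>a. (s, a) \<in> e \<and> (a, a) \<in> e \<and> (a, t) \<in> e"
proof -
  define R where "R = {a. (s, a) \<in> e \<and> (a, t) \<in> e}"
  have tr: "(a, c) \<in> e" if "(a, b) \<in> e" "(b, c) \<in> e" for a b c
    using that assms(3) by blast
  have mid: "\<exists>b. (a, b) \<in> e \<and> (b, c) \<in> e" if "(a, c) \<in> e" for a c
    using that assms(3) by blast
  have fin: "finite {b. (a, b) \<in> e}" for a
    by (rule finite_subset[OF _ assms(1)]) (use assms(2) in blast)
  obtain a0 where "a0 \<in> R" using mid[OF assms(4)] by (auto simp: R_def)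
  then obtain a where a: "a \<in> R" "\<And>b. b \<in> R \<Longrightarrow> card {c. (a, c) \<in> e} \<le> card {c. (b, c) \<in> e}"
    using ex_has_least_nat[of "\<lambda>a. a \<in> R" a0 "\<lambda>a. card {c. (a, c) \<in> e}"] by blast
  have sa: "(s, a) \<in> e" "(a, t) \<in> e" using a(1) by (auto simp: R_def)
  obtain b where b: "(a, b) \<in> e" "(b, t) \<in> e" using mid[OF sa(2)] by blast
  have bR: "b \<in> R" using tr[OF sa(1) b(1)] b(2) by (simp add: R_def)
  have "(b, b) \<in> e"
  proof (rule ccontr)
    assume "(b, b) \<notin> e"
    moreover have "{c. (b, c) \<in> e} \<subseteq> {c. (a, c) \<in> e}" using tr b(1) by blast
    ultimately have "{c. (b, c) \<in> e} \<subset> {c. (a, c) \<in> e}" using b(1) by blast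
    then have "card {c. (b, c) \<in> e} < card {c. (a, c) \<in> e}" by (intro psubset_card_mono fin)
    then show False using a(2)[OF bR] by simp
  qed
  then show ?thesis using bR by (auto simp: R_def)
qed

text \<open>An idempotent below \<open>e\<close> with at least as many images as \<open>e\<close>
  cannot be smaller: by \<open>f O e = f\<close> its images are images under \<open>e\<close>, so
  the two collections coincide and the idempotent \<open>f\<close> fixes every image under
  \<open>e\<close>. With \<open>e O f = f\<close> the two relations have the same images of each
  set.\<close>

lemma idempotent_eqI:
  assumes "finite S" "e \<subseteq> S \<times> S" "e O e = e" "f O f = f" "e O f = f" "f O e = f"
    and "card (range (\<lambda>Z. e `` Z)) \<le> card (range (\<lambda>Z. f `` Z))"
  shows "f = e"
proof -
  have "range (\<lambda>Z. e `` Z) \<subseteq> Pow S" using assms(2) by blast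
  then have fin: "finite (range (\<lambda>Z. e `` Z))" using assms(1) by (meson finite_Pow_iff finite_subset)
  have "f `` Z = e `` (f `` Z)" for Z by (simp only: relcomp_Image[symmetric] assms(6))
  then have "f `` Z \<in> range (\<lambda>Z. e `` Z)" for Z by (rule range_eqI)
  then have "range (\<lambda>Z. f `` Z) \<subseteq> range (\<lambda>Z. e `` Z)" by (rule image_subsetI)
  then have eq: "range (\<lambda>Z. f `` Z) = range (\<lambda>Z. e `` Z)"
    by (rule card_seteq[OF fin _ assms(7)])
  have "f `` Z = e `` Z" for Z
  proof -
    have "e `` Z \<in> range (\<lambda>Z. f `` Z)" unfolding eq by (rule rangeI)
    then obtain Z' where Z': "e `` Z = f `` Z'" by (rule imageE)
    have "f `` Z = f `` (e `` Z)" by (simp only: relcomp_Image[symmetric] assms(5))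
    also have "\<dots> = f `` Z'" by (simp only: Z' relcomp_Image[symmetric] assms(4))
    finally show ?thesis using Z' by simp
  qed
  then have "f `` {s} = e `` {s}" for s .
  then show ?thesis by (auto simp: set_eq_iff)
qed

text \<open>A finite semigroup of relations, indexed by words, that acts transitively on the
  states.\<close>

locale word_relations =
  fixes T :: "'b list \<Rightarrow> ('s \<times> 's) set" and S :: "'s set"
  assumes T_append: "T (u @ v) = T u O T v"
    and finite_S: "finite S"
    and S_nonempty: "S \<noteq> {}"
    and T_subset: "T u \<subseteq> S \<times> S"
    and T_connect: "s \<in> S \<Longrightarrow> t \<in> S \<Longrightarrow> \<exists>u. (s, t) \<in> T u"
begin

lemma T_replicate: "T (concat (replicate (Suc m) u)) = T u ^^ Suc m"
proof (induction m)
  case (Suc m)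
  have "T (concat (replicate (Suc (Suc m)) u)) = T u O T u ^^ Suc m"
    using Suc by (simp add: T_append)
  also have "\<dots> = T u ^^ Suc m O T u" by (rule relpow_commute)
  finally show ?case by (simp only: relpow.simps(2)[symmetric])
qed simp

text \<open>The number of distinct sets reachable from sets of states. For Boolean matrices it is
  the size of the row space, which cannot grow under composition and so detects the minimal
  ideal.\<close>

definition row_number :: "'b list \<Rightarrow> nat" where
  "row_number v = card (range (\<lambda>Z. T v `` Z))"

definition minimal_idempotent :: "'b list \<Rightarrow> bool" where
  "minimal_idempotent w \<longleftrightarrow> T w O T w = T w \<and> T w \<noteq> {} \<and>
     (\<forall>v. T v O T v = T v \<longrightarrow> T v \<noteq> {} \<longrightarrow> row_number w \<le> row_number v)"

lemma minimal_idempotent_exists: "\<exists>w. minimal_idempotent w"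
proof -
  obtain s where "s \<in> S" using S_nonempty by blast
  then obtain u where u: "(s, s) \<in> T u" using T_connect by blast
  obtain m where m: "T u ^^ Suc m O T u ^^ Suc m = T u ^^ Suc m"
    using idempotent_power[OF finite_S T_subset] by blast
  have "(s, s) \<in> T u ^^ Suc m" for m
    by (induction m) (use u in auto)
  then have "T (concat (replicate (Suc m) u)) O T (concat (replicate (Suc m) u)) = T (concat (replicate (Suc m) u))
     \<and> T (concat (replicate (Suc m) u)) \<noteq> {}"
    unfolding T_replicate using m by blast
  from ex_has_least_nat[of "\<lambda>v. T v O T v = T v \<and> T v \<noteq> {}", OF this, of row_number]
  show ?thesis unfolding minimal_idempotent_def by blast
qed

end

locale marked_relations = word_relations T S
  for T :: "'b list \<Rightarrow> ('s \<times> 's) set" and S +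
  fixes w :: "'b list"
  assumes w_minimal: "minimal_idempotent w"
begin

abbreviation e where "e \<equiv> T w"

lemma e_idem: "e O e = e" and e_nonempty: "e \<noteq> {}"
  using w_minimal by (auto simp: minimal_idempotent_def)

lemma e_trans: "(a, b) \<in> e \<Longrightarrow> (b, c) \<in> e \<Longrightarrow> (a, c) \<in> e"
  using e_idem by blast

lemma idempotent_eq_e:
  assumes "T v O T v = T v" "T v \<noteq> {}" "e O T v = T v" "T v O e = T v"
  shows "T v = e"
proof (rule idempotent_eqI[OF finite_S T_subset e_idem assms(1,3,4)])
  show "card (range ((``) e)) \<le> card (range ((``) (T v)))"
    using w_minimal assms(1,2) unfolding minimal_idempotent_def row_number_def by blast
qed

text \<open>The words acting as elements of the maximal subgroup with identity \<open>e\<close>.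
  That they are invertible is shown in \<open>unit_inverse\<close>.\<close>

definition unit :: "'b list \<Rightarrow> bool" where
  "unit v \<longleftrightarrow> T v \<noteq> {} \<and> e O T v = T v \<and> T v O e = T v"

lemma unitI: "T (w @ u @ w) \<noteq> {} \<Longrightarrow> unit (w @ u @ w)"
  unfolding unit_def T_append using e_idem by (metis O_assoc)

text \<open>If \<open>v\<close> relates \<open>s\<close> to \<open>t\<close>, go back from
  \<open>t\<close> to \<open>s\<close> by some \<open>u\<close>. The return loop has nonempty
  powers, one of them is idempotent, and by minimality that one is \<open>e\<close>; all but the
  first factor \<open>T v\<close> is a right inverse.\<close>

lemma unit_right_inverse:
  assumes "unit v"
  shows "\<exists>v'. unit v' \<and> T v O T v' = e"
proof -
  have ev: "e O T v = T v" and ve: "T v O e = T v" and ne: "T v \<noteq> {}"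
    using assms by (auto simp: unit_def)
  obtain s t where st: "(s, t) \<in> T v" using ne by auto
  then have "s \<in> S" "t \<in> S" using T_subset[of v] by auto
  then obtain u where u: "(t, s) \<in> T u" using T_connect by blast
  define q where "q = v @ w @ u @ w"
  have q: "T q = T v O T u O e" unfolding q_def T_append using ve by (metis O_assoc)
  have eq: "e O T q = T q" and qe: "T q O e = T q"
    unfolding q using ev e_idem by (metis O_assoc)+
  have "(s, t) \<in> T q ^^ m O T v" for m
  proof (induction m)
    case 0
    then show ?case using st by simp
  next
    case (Suc m)
    have "(s, t) \<in> (T q ^^ m O T v) O T u O T v" using Suc u st by blast
    also have "\<dots> = T q ^^ m O (T v O T u O e) O T v" using ev by (metis O_assoc)
    also have "\<dots> = T q ^^ Suc m O T v" by (simp add: q O_assoc)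
    finally show ?case .
  qed
  then have pow_ne: "T q ^^ m \<noteq> {}" for m by fastforce
  obtain m where m: "T q ^^ Suc m O T q ^^ Suc m = T q ^^ Suc m"
    using idempotent_power[OF finite_S T_subset] by blast
  have "e O T q ^^ Suc m = T q ^^ Suc m"
    using eq by (metis O_assoc relpow.simps(2) relpow_commute)
  moreover have "T q ^^ Suc m O e = T q ^^ Suc m"
    using qe by (metis O_assoc relpow.simps(2))
  ultimately have f: "T q ^^ Suc m = e"
    using idempotent_eq_e[of "concat (replicate (Suc m) q)"] m pow_ne[of "Suc m"]
    unfolding T_replicate by blast
  \<comment> \<open>the last \<open>w\<close> yields \<open>T v' O e = T v'\<close> without distinguishing the case \<open>m = 0\<close>\<close>
  define v' where "v' = w @ u @ w @ concat (replicate m q) @ w"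
  have Tm: "T (w @ concat (replicate m q)) = e O T q ^^ m"
    by (cases m) (simp, simp only: T_append T_replicate)
  have v': "T v' = e O T u O e O T q ^^ m O e"
  proof -
    have "T v' = e O T u O T (w @ concat (replicate m q)) O e"
      unfolding v'_def by (metis T_append append_assoc)
    then show ?thesis by (simp add: Tm O_assoc)
  qed
  have "T v O T v' = T v O T u O e O T q ^^ m O e" unfolding v' using ve by (metis O_assoc)
  also have "\<dots> = (T q O T q ^^ m) O e" by (simp add: q O_assoc)
  also have "\<dots> = e" using f e_idem by (simp add: relpow_commute)
  finally have inv: "T v O T v' = e" .
  have "T v' \<noteq> {}" using inv e_nonempty by auto
  moreover have "e O T v' = T v'" "T v' O e = T v'" unfolding v' using e_idem by (metis O_assoc)+
  ultimately show ?thesis using inv unfolding unit_def by blast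
qed

text \<open>In a monoid in which every element has a right inverse, right inverses are
  two-sided.\<close>

lemma unit_inverse:
  assumes "unit v"
  obtains v' where "unit v'" "T v O T v' = e" "T v' O T v = e"
proof -
  obtain v' where v': "unit v'" "T v O T v' = e" using unit_right_inverse[OF assms] by blast
  obtain v'' where v'': "unit v''" "T v' O T v'' = e" using unit_right_inverse[OF v'(1)] by blast
  have "T v = T v O T v' O T v''" using assms v''(2) by (simp add: unit_def)
  also have "\<dots> = e O T v''" using v'(2) by (metis O_assoc)
  also have "\<dots> = T v''" using v''(1) by (simp add: unit_def)
  finally have "T v' O T v = e" using v''(2) by simp
  then show ?thesis by (rule that[OF v'])
qed

lemma unit_power:
  assumes "unit v" shows "\<exists>m. T v ^^ Suc m = e"
proof -
  obtain v' where v': "T v O T v' = e" using assms by (rule unit_inverse)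
  have ev: "e O T v = T v" and ve: "T v O e = T v" and ne: "T v \<noteq> {}"
    using assms by (auto simp: unit_def)
  have pow_ne: "T v ^^ Suc m \<noteq> {}" for m
  proof (induction m)
    case (Suc m)
    have "T v ^^ Suc (Suc m) O T v' = T v ^^ Suc m"
      using v' ve by (metis O_assoc relpow.simps(2))
    then show ?case using Suc by auto
  qed (simp add: ne)
  obtain m where m: "T v ^^ Suc m O T v ^^ Suc m = T v ^^ Suc m"
    using idempotent_power[OF finite_S T_subset] by blast
  have "e O T v ^^ Suc m = T v ^^ Suc m"
    using ev by (metis O_assoc relpow.simps(2) relpow_commute)
  moreover have "T v ^^ Suc m O e = T v ^^ Suc m"
    using ve by (metis O_assoc relpow.simps(2))
  ultimately have "T v ^^ Suc m = e"
    using idempotent_eq_e[of "concat (replicate (Suc m) v)"] m pow_ne[of m]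
    unfolding T_replicate by blast
  then show ?thesis ..
qed

text \<open>A pair whose first component the unit can also repeat survives in all powers of the
  unit, one of which is \<open>e\<close>.\<close>

lemma e_if_unit_loop:
  assumes "unit v" "(a, a) \<in> T v" "(a, b) \<in> T v"
  shows "(a, b) \<in> e"
proof -
  obtain m where m: "T v ^^ Suc m = e" using unit_power[OF assms(1)] by blast
  have "(a, a) \<in> T v ^^ m" for m by (induction m) (use assms(2) in auto)
  then have "(a, b) \<in> T v ^^ Suc m" using assms(3) by auto
  then show ?thesis using m by simp
qed

text \<open>On recurrent states \<open>e\<close> is an equivalence relation. Closing \<open>(a,
  b)\<close> up to a loop by a word from \<open>b\<close> to \<open>a\<close> gives a unit that
  contains both \<open>(b, b)\<close> and \<open>(b, a)\<close>.\<close>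

lemma e_sym:
  assumes "(a, a) \<in> e" "(b, b) \<in> e" "(a, b) \<in> e"
  shows "(b, a) \<in> e"
proof -
  have "a \<in> S" "b \<in> S" using assms T_subset[of w] by auto
  then obtain u where u: "(b, a) \<in> T u" using T_connect by blast
  have "(b, a) \<in> T (w @ u @ w)" "(b, b) \<in> T (w @ u @ w)"
    unfolding T_append using u assms by blast+
  moreover from this have "unit (w @ u @ w)" by (intro unitI) auto
  ultimately show ?thesis by (rule_tac e_if_unit_loop)
qed

text \<open>The recurrent states through which the pair \<open>(s, t)\<close> can be routed. By
  \<open>mark_equiv\<close> and \<open>mark_mono\<close> this is one equivalence class of
  recurrent states, which avoids choosing representatives.\<close>

definition mark :: "'s \<Rightarrow> 's \<Rightarrow> 's set" where
  "mark s t = {a. (s, a) \<in> e \<and> (a, a) \<in> e \<and> (a, t) \<in> e}"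

lemma mark_subset: "mark s t \<subseteq> S"
  using T_subset[of w] by (auto simp: mark_def)

lemma mark_nonempty: "(s, t) \<in> e \<Longrightarrow> mark s t \<noteq> {}"
  using idempotent_middle[OF finite_S T_subset e_idem, of s t] by (auto simp: mark_def)

text \<open>If recurrent \<open>a\<close>, \<open>b\<close> both join \<open>s\<close> to
  \<open>t\<close>, then a return from \<open>t\<close> to \<open>s\<close> gives a unit
  containing both \<open>(a, a)\<close> and \<open>(a, b)\<close>.\<close>

lemma mark_equiv:
  assumes "a \<in> mark s t" "b \<in> mark s t" shows "(a, b) \<in> e"
proof -
  have "s \<in> S" "t \<in> S" using assms T_subset[of w] by (auto simp: mark_def)
  then obtain u where u: "(t, s) \<in> T u" using T_connect by blast
  have "(a, b) \<in> T (w @ u @ w)" "(a, a) \<in> T (w @ u @ w)"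
    unfolding T_append using u assms unfolding mark_def by blast+
  moreover from this have "unit (w @ u @ w)" by (intro unitI) auto
  ultimately show ?thesis by (rule_tac e_if_unit_loop)
qed

lemma mark_mono:
  assumes "a \<in> mark s t" "(a, b) \<in> e" "(b, b) \<in> e" shows "b \<in> mark s t"
  using assms e_sym[of a b] e_trans unfolding mark_def by blast

lemma mark_eqI:
  assumes "a \<in> mark s t" "b \<in> mark s' t'" "(a, b) \<in> e" shows "mark s t = mark s' t'"
proof -
  have rec: "(c, c) \<in> e" if "c \<in> mark s t" for c s t using that by (simp add: mark_def)
  have ba: "(b, a) \<in> e" using e_sym[OF rec[OF assms(1)] rec[OF assms(2)] assms(3)] .
  have "c \<in> mark s' t'" if "c \<in> mark s t" for c
    using mark_mono[OF assms(2) e_trans[OF ba mark_equiv[OF assms(1) that]] rec[OF that]] .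
  moreover have "c \<in> mark s t" if "c \<in> mark s' t'" for c
    using mark_mono[OF assms(1) e_trans[OF assms(3) mark_equiv[OF assms(2) that]] rec[OF that]] .
  ultimately show ?thesis by blast
qed

lemma mark_self: "a \<in> mark s t \<Longrightarrow> mark a a = mark s t"
  by (rule mark_eqI[of a _ _ a]) (auto simp: mark_def)

text \<open>On recurrent states the inverse unit is the converse relation, just as the invertible
  Boolean matrices are the permutation matrices. The witness is a recurrent state \<open>c\<close>
  on a loop from \<open>b\<close> to \<open>b\<close> through the inverse, which has to be
  equivalent to \<open>a\<close>.\<close>

lemma unit_converse:
  assumes "T v O T v' = e" "T v' O T v = e" "unit v'" "(a, a) \<in> e" "(b, b) \<in> e" "(a, b) \<in> T v"
  shows "(b, a) \<in> T v'"
proof -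
  have v'e: "T v' O e = T v'" using assms(3) by (simp add: unit_def)
  have "(b, b) \<in> (T v' O e) O T v" using assms(2,5) v'e by simp
  then obtain p q where pq: "(b, p) \<in> T v'" "(p, q) \<in> e" "(q, b) \<in> T v" by blast
  obtain c where c: "(p, c) \<in> e" "(c, c) \<in> e" "(c, q) \<in> e"
    using idempotent_middle[OF finite_S T_subset e_idem pq(2)] by blast
  have bc: "(b, c) \<in> T v'" using pq(1) c(1) v'e by blast
  then have "(a, c) \<in> e" using assms(1,6) by blast
  then have "(c, a) \<in> e" using e_sym assms(4) c(2) by blast
  then show ?thesis using bc v'e by blast
qed

text \<open>A unit induces a well-defined map on classes of recurrent states.\<close>

lemma unit_forward:
  assumes "unit v" "(a, b) \<in> T v" "(a', b') \<in> T v" "(a, a') \<in> e"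
    "(a, a) \<in> e" "(b, b) \<in> e" "(a', a') \<in> e" "(b', b') \<in> e"
  shows "(b, b') \<in> e"
proof -
  obtain v' where v': "unit v'" "T v O T v' = e" "T v' O T v = e" using assms(1) by (rule unit_inverse)
  have "(b, a) \<in> T v'" using unit_converse[OF v'(2,3,1)] assms by blast
  moreover have "(a, b') \<in> T v" using assms(1,3,4) unfolding unit_def by blast
  ultimately show ?thesis using v'(3) by blast
qed

text \<open>The map that a unit induces on classes is injective.\<close>

lemma unit_backward:
  assumes "unit v" "(a, b) \<in> T v" "(a', b') \<in> T v" "(b, b') \<in> e"
    "(a, a) \<in> e" "(b, b) \<in> e" "(a', a') \<in> e" "(b', b') \<in> e"
  shows "(a, a') \<in> e"
proof -
  obtain v' where v': "unit v'" "T v O T v' = e" "T v' O T v = e" using assms(1) by (rule unit_inverse)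
  have "(b', a') \<in> T v'" using unit_converse[OF v'(2,3,1)] assms by blast
  moreover have "(a, b') \<in> T v" using assms(1,2,4) unfolding unit_def by blast
  ultimately show ?thesis using v'(2) by blast
qed

text \<open>The map that a unit induces on classes is defined everywhere and onto. For both parts,
  \<open>(a, a) \<in> e\<close> is factored through the unit and its inverse, with a recurrent
  state inserted in between.\<close>

lemma unit_total:
  assumes "unit v" "(a, a) \<in> e"
  shows "\<exists>b. (b, b) \<in> e \<and> (a, b) \<in> T v" and "\<exists>b. (b, b) \<in> e \<and> (b, a) \<in> T v"
proof -
  obtain v' where v': "unit v'" "T v O T v' = e" "T v' O T v = e" using assms(1) by (rule unit_inverse)
  have ve: "T v O e = T v" "e O T v = T v" using assms(1) by (auto simp: unit_def)
  have "(a, a) \<in> (T v O e) O T v'" using v'(2) ve assms(2) by simp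
  then obtain p q where pq: "(a, p) \<in> T v" "(p, q) \<in> e" by blast
  obtain c where c: "(p, c) \<in> e" "(c, c) \<in> e"
    using idempotent_middle[OF finite_S T_subset e_idem pq(2)] by blast
  then show "\<exists>b. (b, b) \<in> e \<and> (a, b) \<in> T v" using pq(1) ve by blast
  have "(a, a) \<in> T v' O e O T v" using v'(3) ve assms(2) by simp
  then obtain p q where pq: "(q, a) \<in> T v" "(p, q) \<in> e" by blast
  obtain c where c: "(c, q) \<in> e" "(c, c) \<in> e"
    using idempotent_middle[OF finite_S T_subset e_idem pq(2)] by blast
  then show "\<exists>b. (b, b) \<in> e \<and> (b, a) \<in> T v" using pq(1) ve by blast
qed

definition marks :: "'s set set" where
  "marks = (\<lambda>a. mark a a) ` {a. (a, a) \<in> e}"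

lemma finite_marks: "finite marks"
proof -
  have "marks \<subseteq> Pow S" using mark_subset by (auto simp: marks_def)
  then show ?thesis using finite_S by (meson finite_Pow_iff finite_subset)
qed

lemma mark_in_marks: "(s, t) \<in> e \<Longrightarrow> mark s t \<in> marks"
proof -
  assume "(s, t) \<in> e"
  then obtain a where "a \<in> mark s t" using mark_nonempty by blast
  moreover from this have "(a, a) \<in> e" by (simp add: mark_def)
  ultimately show ?thesis unfolding marks_def using mark_self by blast
qed

end

section \<open>The relations of a factor code\<close>

text \<open>An irreducible shift in which points agreeing on a window of radius \<open>N\<close>
  can be spliced, with a block code of the same radius. Windows of that radius play the role of
  the vertices of a graph presenting \<open>X\<close>.\<close>

locale factor_setup =
  fixes X :: "(int \<Rightarrow> 'a) set" and \<pi> :: "(int \<Rightarrow> 'a) \<Rightarrow> (int \<Rightarrow> 'b)" and N :: nat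
  assumes irreducible: "irreducible_shift X"
    and nonempty: "X \<noteq> {}"
    and radius: "block_code N X \<pi>"
    and splice: "x \<in> X \<Longrightarrow> x' \<in> X \<Longrightarrow> \<forall>k. \<bar>k\<bar> \<le> int N \<longrightarrow> x (i + k) = x' (i + k) \<Longrightarrow>
      (\<lambda>j. if j \<le> i then x j else x' j) \<in> X"
begin

lemma shift_space: "shift_space X"
  using irreducible by (simp add: irreducible_shift_def)

lemma shift_mem: "x \<in> X \<Longrightarrow> shift_pow k x \<in> X"
  by (rule shift_space_shift_pow[OF shift_space])

definition state :: "(int \<Rightarrow> 'a) \<Rightarrow> int \<Rightarrow> 'a list" where
  "state x i = block x (i - int N) (2 * N + 1)"

lemma state_eq_iff: "state x i = state x' i' \<longleftrightarrow> (\<forall>k. \<bar>k\<bar> \<le> int N \<longrightarrow> x (i + k) = x' (i' + k))"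
proof
  assume eq: "state x i = state x' i'"
  show "\<forall>k. \<bar>k\<bar> \<le> int N \<longrightarrow> x (i + k) = x' (i' + k)"
  proof (intro allI impI)
    fix k assume "\<bar>k\<bar> \<le> int N"
    then have "nat (k + int N) < 2 * N + 1" "int (nat (k + int N)) = k + int N" by auto
    moreover from eq have "state x i ! nat (k + int N) = state x' i' ! nat (k + int N)" by simp
    ultimately show "x (i + k) = x' (i' + k)" unfolding state_def by (simp add: algebra_simps)
  qed
next
  assume a: "\<forall>k. \<bar>k\<bar> \<le> int N \<longrightarrow> x (i + k) = x' (i' + k)"
  have "x (i - int N + int j) = x' (i' - int N + int j)" if "j < 2 * N + 1" for j
    using a[rule_format, of "int j - int N"] that by (simp add: algebra_simps)
  then show "state x i = state x' i'"
    unfolding state_def by (intro nth_equalityI) simp_all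
qed

lemma state_symbol: "state x i = state x' i' \<Longrightarrow> x i = x' i'"
  unfolding state_eq_iff by (drule spec[of _ 0]) simp

lemma state_shift: "state (shift_pow k x) i = state x (i + k)"
  unfolding state_eq_iff by (simp add: shift_pow_def add_ac)

lemma image_state: "x \<in> X \<Longrightarrow> x' \<in> X \<Longrightarrow> state x i = state x' i' \<Longrightarrow> \<pi> x i = \<pi> x' i'"
  by (rule block_codeD[OF radius]) (simp_all add: state_eq_iff)

lemma image_shift: "x \<in> X \<Longrightarrow> \<pi> (shift_pow k x) i = \<pi> x (i + k)"
  by (rule image_state[OF shift_mem]) (simp_all add: state_shift)

text \<open>The spliced point agrees with each of the two points up to \<open>N\<close> positions
  beyond the splicing position, which is why whole states are inherited on either side.\<close>

lemma splice_states:
  assumes "x \<in> X" "x' \<in> X" "state x i = state x' i"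
  shows "\<exists>z\<in>X. (\<forall>j\<le>i. state z j = state x j) \<and> (\<forall>j\<ge>i. state z j = state x' j)"
proof -
  define z where "z = (\<lambda>j. if j \<le> i then x j else x' j)"
  have eq: "x (i + k) = x' (i + k)" if "\<bar>k\<bar> \<le> int N" for k
    using assms(3) that unfolding state_eq_iff by simp
  have "z \<in> X" unfolding z_def using eq by (intro splice assms) simp
  moreover have l: "z j = x j" if "j \<le> i + int N" for j
    using eq[of "j - i"] that by (simp add: z_def)
  moreover have r: "z j = x' j" if "j \<ge> i - int N" for j
    using eq[of "j - i"] that by (simp add: z_def)
  moreover have "state z j = state x j" if "j \<le> i" for j
    unfolding state_eq_iff using that by (intro allI impI l) linarith
  moreover have "state z j = state x' j" if "j \<ge> i" for j
    unfolding state_eq_iff using that by (intro allI impI r) linarith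
  ultimately show ?thesis by (intro bexI[of _ z]) simp_all
qed

definition T :: "'b list \<Rightarrow> ('a list \<times> 'a list) set" where
  "T v = {(state x 0, state x (int (length v))) | x. x \<in> X \<and> block (\<pi> x) 0 (length v) = v}"

definition S :: "'a list set" where
  "S = (\<lambda>x. state x 0) ` X"

lemma state_in_S: "x \<in> X \<Longrightarrow> state x i \<in> S"
  unfolding S_def using shift_mem[of x i] state_shift[of i x 0] by force

lemma T_block:
  assumes "x \<in> X" shows "(state x i, state x (i + int n)) \<in> T (block (\<pi> x) i n)"
proof -
  have "block (\<pi> (shift_pow i x)) 0 n = block (\<pi> x) i n"
    using image_shift[OF assms] by (intro nth_equalityI) (simp_all add: add_ac)
  then show ?thesis
    unfolding T_def using shift_mem[OF assms, of i] state_shift[of i x]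
    by (intro CollectI exI[of _ "shift_pow i x"]) (simp add: add_ac)
qed

text \<open>Shift-invariance: a pair in \<open>T v\<close> is realized by a point of
  \<open>X\<close> at any prescribed position.\<close>

lemma T_realize:
  assumes "(s, t) \<in> T v"
  shows "\<exists>x\<in>X. state x i = s \<and> state x (i + int (length v)) = t \<and> block (\<pi> x) i (length v) = v"
proof -
  obtain x where x: "x \<in> X" "s = state x 0" "t = state x (int (length v))" "block (\<pi> x) 0 (length v) = v"
    using assms unfolding T_def by blast
  have "block (\<pi> (shift_pow (- i) x)) i (length v) = block (\<pi> x) 0 (length v)"
    using image_shift[OF x(1)] by (intro nth_equalityI) simp_all
  then show ?thesis
    using x shift_mem[OF x(1), of "- i"] state_shift[of "- i" x]
    by (intro bexI[of _ "shift_pow (- i) x"]) simp_all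
qed

lemma T_append: "T (u @ v) = T u O T v"
proof (intro equalityI subrelI)
  fix s t assume "(s, t) \<in> T (u @ v)"
  then obtain x where x: "x \<in> X" "state x 0 = s" "state x (0 + int (length (u @ v))) = t"
    "block (\<pi> x) 0 (length (u @ v)) = u @ v"
    using T_realize[of s t "u @ v" 0] by blast
  then have b: "block (\<pi> x) 0 (length u) = u" "block (\<pi> x) (int (length u)) (length v) = v"
    by (simp_all add: block_append)
  have "(s, state x (int (length u))) \<in> T u"
    using T_block[OF x(1), of 0 "length u"] b x by simp
  moreover have "(state x (int (length u)), t) \<in> T v"
    using T_block[OF x(1), of "int (length u)" "length v"] b x by simp
  ultimately show "(s, t) \<in> T u O T v" by blast
next
  fix s t assume "(s, t) \<in> T u O T v"
  then obtain r where r: "(s, r) \<in> T u" "(r, t) \<in> T v" by blast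
  obtain x where x: "x \<in> X" "state x 0 = s" "state x (0 + int (length u)) = r" "block (\<pi> x) 0 (length u) = u"
    using T_realize[OF r(1), of 0] by blast
  obtain x' where x': "x' \<in> X" "state x' (int (length u)) = r" "state x' (int (length u) + int (length v)) = t"
    "block (\<pi> x') (int (length u)) (length v) = v"
    using T_realize[OF r(2), of "int (length u)"] by blast
  obtain z where z: "z \<in> X" "\<forall>j\<le>int (length u). state z j = state x j" "\<forall>j\<ge>int (length u). state z j = state x' j"
    using splice_states[OF x(1) x'(1), of "int (length u)"] x(3) x'(2) by auto
  have "block (\<pi> z) 0 (length u) = block (\<pi> x) 0 (length u)"
    by (intro nth_equalityI) (simp_all add: image_state[OF z(1) x(1)] z(2))
  moreover have "block (\<pi> z) (int (length u)) (length v) = block (\<pi> x') (int (length u)) (length v)"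
    by (intro nth_equalityI) (simp_all add: image_state[OF z(1) x'(1)] z(3))
  ultimately have "block (\<pi> z) 0 (length (u @ v)) = u @ v"
    using x(4) x'(4) by (simp add: block_append)
  moreover have "state z 0 = s" "state z (0 + int (length (u @ v))) = t" using z(2,3) x(2) x'(3) by simp_all
  ultimately show "(s, t) \<in> T (u @ v)"
    using T_block[OF z(1), of 0 "length (u @ v)"] by simp
qed

lemma finite_S: "finite S"
proof -
  obtain A where A: "finite A" "\<forall>x\<in>X. range x \<subseteq> A" using shift_space_alphabet[OF shift_space] by blast
  have "S \<subseteq> {l. set l \<subseteq> A \<and> length l = 2 * N + 1}"
    unfolding S_def state_def block_def using A(2) by (auto simp: image_subset_iff)
  then show ?thesis using finite_lists_length_eq[OF A(1)] finite_subset by blast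
qed

lemma T_subset: "T u \<subseteq> S \<times> S"
  unfolding T_def using state_in_S by auto

lemma T_connect:
  assumes "s \<in> S" "t \<in> S" shows "\<exists>u. (s, t) \<in> T u"
proof -
  obtain x x' where x: "x \<in> X" "x' \<in> X" "s = state x 0" "t = state x' 0"
    using assms unfolding S_def by blast
  let ?m = "2 * N + 1"
  obtain z l where z: "z \<in> X" "block z 0 ?m = block x (0 - int N) ?m"
    "block z (int (?m + l)) ?m = block x' (0 - int N) ?m"
    by (rule irreducible_connect[OF irreducible x(1,2)])
  have "state z (int N) = s" "state z (int N + int (?m + l)) = t"
    unfolding x(3,4) using z(2,3) by (simp_all add: state_def add_ac)
  then show ?thesis using T_block[OF z(1), of "int N" "?m + l"] by metis
qed

sublocale word_relations T S
  by unfold_locales (use T_append finite_S nonempty T_subset T_connect in \<open>auto simp: S_def[of]\<close>)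

end


section \<open>Marks along a point\<close>

locale marked_setup = factor_setup X \<pi> N
  for X :: "(int \<Rightarrow> 'a) set" and \<pi> :: "(int \<Rightarrow> 'a) \<Rightarrow> (int \<Rightarrow> 'b)" and N +
  fixes w :: "'b list"
  assumes minimal: "minimal_idempotent w"
begin

sublocale marked_relations T S w
  by unfold_locales (rule minimal)

abbreviation L :: int where "L \<equiv> int (length w)"

definition w_at :: "(int \<Rightarrow> 'b) \<Rightarrow> int \<Rightarrow> bool" where
  "w_at y i \<longleftrightarrow> block y i (length w) = w"

text \<open>The empty set serves as the symbol for positions without an occurrence of
  \<open>w\<close>; it is never the mark of an occurrence.\<close>

definition mark_at :: "(int \<Rightarrow> 'a) \<Rightarrow> int \<Rightarrow> 'a list set" where
  "mark_at x i = (if w_at (\<pi> x) i then mark (state x i) (state x (i + L)) else {})"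

lemma w_at_agree:
  assumes "w_at y i" "\<And>k. i \<le> k \<Longrightarrow> k < i + L \<Longrightarrow> y k = y' k" shows "w_at y' i"
proof -
  have "block y i (length w) = block y' i (length w)"
    by (intro nth_equalityI) (simp_all add: assms(2))
  then show ?thesis using assms(1) by (simp add: w_at_def)
qed

lemma w_at_e: "x \<in> X \<Longrightarrow> w_at (\<pi> x) i \<Longrightarrow> (state x i, state x (i + L)) \<in> e"
  using T_block[of x i "length w"] by (simp add: w_at_def)

lemma mark_at_nonempty: "x \<in> X \<Longrightarrow> w_at (\<pi> x) i \<Longrightarrow> mark_at x i \<noteq> {}"
  unfolding mark_at_def using mark_nonempty[OF w_at_e] by simp

lemma mark_at_in_marks: "x \<in> X \<Longrightarrow> w_at (\<pi> x) i \<Longrightarrow> mark_at x i \<in> marks"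
  unfolding mark_at_def using mark_in_marks[OF w_at_e] by simp

lemma mark_at_recurrent: "a \<in> mark_at x i \<Longrightarrow> (a, a) \<in> e"
  unfolding mark_at_def mark_def by (simp split: if_splits)

lemma mark_at_equiv: "a \<in> mark_at x i \<Longrightarrow> b \<in> mark_at x i \<Longrightarrow> (a, b) \<in> e"
  unfolding mark_at_def using mark_equiv by (simp split: if_splits)

lemma mark_at_eqI: "a \<in> mark_at x i \<Longrightarrow> b \<in> mark_at x' j \<Longrightarrow> (a, b) \<in> e \<Longrightarrow> mark_at x i = mark_at x' j"
  unfolding mark_at_def using mark_eqI by (simp split: if_splits)

lemma mark_at_cong:
  assumes "w_at (\<pi> x) i" "w_at (\<pi> x') i'" "state x i = state x' i'" "state x (i + L) = state x' (i' + L)"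
  shows "mark_at x i = mark_at x' i'"
  using assms by (simp add: mark_at_def)

definition between :: "(int \<Rightarrow> 'b) \<Rightarrow> int \<Rightarrow> int \<Rightarrow> 'b list" where
  "between y p q = block y p (nat (q + L - p))"

lemma between_split:
  assumes "w_at y p" "w_at y q" "p + L \<le> q"
  shows "between y p q = w @ block y (p + L) (nat (q - (p + L))) @ w"
proof -
  have "nat (q + L - p) = length w + (nat (q - (p + L)) + length w)" using assms(3) by simp
  moreover have "p + L + int (nat (q - (p + L))) = q" using assms(3) by simp
  ultimately show ?thesis
    using assms(1,2) unfolding between_def w_at_def by (simp only: block_append)
qed

text \<open>A word that starts and ends with \<open>w\<close> is sandwiched between two copies of
  \<open>e\<close>.\<close>

lemma between_unit:
  assumes "x \<in> X" "w_at (\<pi> x) p" "w_at (\<pi> x) q" "p + L \<le> q"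
  shows "unit (between (\<pi> x) p q)"
proof -
  have "T (between (\<pi> x) p q) \<noteq> {}"
    unfolding between_def using T_block[OF assms(1)] by blast
  then show ?thesis unfolding between_split[OF assms(2-4)] by (rule unitI)
qed

lemma marks_joined:
  assumes "x \<in> X" "w_at (\<pi> x) p" "w_at (\<pi> x) q" "p + L \<le> q" "a \<in> mark_at x p" "b \<in> mark_at x q"
  shows "(a, b) \<in> T (between (\<pi> x) p q)"
proof -
  have "(a, state x (p + L)) \<in> e" "(state x q, b) \<in> e"
    using assms(2,3,5,6) by (simp_all add: mark_at_def mark_def)
  moreover have "(state x (p + L), state x q) \<in> T (block (\<pi> x) (p + L) (nat (q - (p + L))))"
    using T_block[OF assms(1), of "p + L" "nat (q - (p + L))"] assms(4) by simp
  ultimately show ?thesis unfolding between_split[OF assms(2-4)] T_append by blast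
qed

text \<open>The stretch between the two occurrences acts as a unit, hence permutes the marks, and
  the permutation depends only on the image.\<close>

lemma mark_at_determined:
  assumes x: "x \<in> X" "x' \<in> X" and o: "w_at (\<pi> x) p" "w_at (\<pi> x) q" "p + L \<le> q"
    and same: "\<And>k. p \<le> k \<Longrightarrow> k < q + L \<Longrightarrow> \<pi> x k = \<pi> x' k"
  shows "mark_at x p = mark_at x' p \<longleftrightarrow> mark_at x q = mark_at x' q"
proof -
  have o': "w_at (\<pi> x') p" "w_at (\<pi> x') q"
    by (rule w_at_agree[OF o(1)], use same o(3) in simp) (rule w_at_agree[OF o(2)], use same o(3) in simp)
  have eq: "between (\<pi> x) p q = between (\<pi> x') p q"
    unfolding between_def using o(3) by (intro nth_equalityI) (simp_all add: same)
  obtain a b where ab: "a \<in> mark_at x p" "b \<in> mark_at x q" using mark_at_nonempty x o by blast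
  obtain a' b' where ab': "a' \<in> mark_at x' p" "b' \<in> mark_at x' q" using mark_at_nonempty x o' by blast
  let ?v = "between (\<pi> x) p q"
  have u: "unit ?v" by (rule between_unit[OF x(1) o])
  have j: "(a, b) \<in> T ?v" by (rule marks_joined[OF x(1) o ab])
  have j': "(a', b') \<in> T ?v" unfolding eq by (rule marks_joined[OF x(2) o' o(3) ab'])
  note r = mark_at_recurrent[OF ab(1)] mark_at_recurrent[OF ab(2)] mark_at_recurrent[OF ab'(1)] mark_at_recurrent[OF ab'(2)]
  show ?thesis
  proof
    assume "mark_at x p = mark_at x' p"
    then have "(a, a') \<in> e" using ab(1) ab'(1) by (intro mark_at_equiv[of a x p a']) simp_all
    from mark_at_eqI[OF ab(2) ab'(2) unit_forward[OF u j j' this r]] show "mark_at x q = mark_at x' q" .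
  next
    assume "mark_at x q = mark_at x' q"
    then have "(b, b') \<in> e" using ab(2) ab'(2) by (intro mark_at_equiv[of b x q b']) simp_all
    from mark_at_eqI[OF ab(1) ab'(1) unit_backward[OF u j j' this r]] show "mark_at x p = mark_at x' p" .
  qed
qed

text \<open>Points with equal marks at an occurrence of \<open>w\<close> can be joined inside it:
  go from the first point to a recurrent state in the common mark and on to the second point. The
  mark does not change because that recurrent state still witnesses it.\<close>

lemma reroute:
  assumes x: "x \<in> X" "x' \<in> X" and o: "w_at (\<pi> x) i" "w_at (\<pi> x') i" and m: "mark_at x i = mark_at x' i"
  shows "\<exists>z\<in>X. (\<forall>j\<le>i. state z j = state x j) \<and> (\<forall>j\<ge>i + L. state z j = state x' j) \<and>
    w_at (\<pi> z) i \<and> mark_at z i = mark_at x i"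
proof -
  obtain a where a: "a \<in> mark_at x i" using mark_at_nonempty[OF x(1) o(1)] by blast
  then have sa: "(state x i, a) \<in> e" "(a, a) \<in> e" "(a, state x' (i + L)) \<in> e"
    using o m by (auto simp: mark_at_def mark_def)
  then have "(state x i, state x' (i + L)) \<in> e" using e_trans by blast
  from T_realize[OF this, of i] obtain r where r: "r \<in> X" "state r i = state x i"
    "state r (i + L) = state x' (i + L)" "block (\<pi> r) i (length w) = w" by blast
  obtain z1 where z1: "z1 \<in> X" "\<forall>j\<le>i. state z1 j = state x j" "\<forall>j\<ge>i. state z1 j = state r j"
    using splice_states[OF x(1) r(1) r(2)[symmetric]] by blast
  have "state z1 (i + L) = state x' (i + L)" using z1(3) r(3) by simp
  from splice_states[OF z1(1) x(2) this] obtain z where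
    z: "z \<in> X" "\<forall>j\<le>i + L. state z j = state z1 j" "\<forall>j\<ge>i + L. state z j = state x' j" by blast
  have "w_at (\<pi> r) i" using r(4) by (simp add: w_at_def)
  then have oz: "w_at (\<pi> z) i"
  proof (rule w_at_agree)
    fix k assume "i \<le> k" "k < i + L"
    then show "\<pi> r k = \<pi> z k" by (intro image_state r(1) z(1)) (simp add: z(2) z1(3))
  qed
  have st: "state z i = state x i" by (simp add: z(2) z1(2))
  have st': "state z (i + L) = state x' (i + L)" by (simp add: z(3))
  have "a \<in> mark_at z i" using sa oz by (simp add: mark_at_def mark_def st st')
  then have "mark_at z i = mark_at x i" using mark_at_eqI[OF _ a sa(2)] by blast
  moreover have "\<forall>j\<le>i. state z j = state x j" using z(2) z1(2) by simp
  ultimately show ?thesis using z(1,3) oz by blast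
qed

text \<open>Since units are total on marks, a path over the same image word can start in any
  recurrent state.\<close>

lemma mark_realized_left:
  assumes x: "x \<in> X" "w_at (\<pi> x) p" "w_at (\<pi> x) q" "p + L \<le> q" and C: "C \<in> marks"
  shows "\<exists>z\<in>X. mark_at z p = C \<and> (\<forall>k. p \<le> k \<longrightarrow> k < q + L \<longrightarrow> \<pi> z k = \<pi> x k)"
proof -
  obtain a where a: "(a, a) \<in> e" "C = mark a a" using C unfolding marks_def by blast
  obtain b where b: "(a, b) \<in> T (between (\<pi> x) p q)" using unit_total(1)[OF between_unit[OF x] a(1)] by blast
  obtain z where z: "z \<in> X" "state z p = a"
    "block (\<pi> z) p (length (between (\<pi> x) p q)) = between (\<pi> x) p q"
    using T_realize[OF b, of p] by blast
  have ag: "\<pi> z k = \<pi> x k" if "p \<le> k" "k < q + L" for k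
    using arg_cong[OF z(3), of "\<lambda>l. l ! nat (k - p)"] that unfolding between_def by simp
  have o: "w_at (\<pi> z) p" by (rule w_at_agree[OF x(2)]) (use ag x(4) in simp)
  have "a \<in> mark_at z p" using o w_at_e[OF z(1) o] a(1) z(2) by (simp add: mark_at_def mark_def)
  then have "mark_at z p = C" using o a(2) mark_self by (simp add: mark_at_def)
  then show ?thesis using z(1) ag by blast
qed

lemma mark_realized_right:
  assumes x: "x \<in> X" "w_at (\<pi> x) p" "w_at (\<pi> x) q" "p + L \<le> q" and C: "C \<in> marks"
  shows "\<exists>z\<in>X. mark_at z q = C \<and> (\<forall>k. p \<le> k \<longrightarrow> k < q + L \<longrightarrow> \<pi> z k = \<pi> x k)"
proof -
  obtain a where a: "(a, a) \<in> e" "C = mark a a" using C unfolding marks_def by blast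
  obtain b where b: "(b, a) \<in> T (between (\<pi> x) p q)" using unit_total(2)[OF between_unit[OF x] a(1)] by blast
  have len: "p + int (length (between (\<pi> x) p q)) = q + L" using x(4) by (simp add: between_def)
  obtain z where z: "z \<in> X" "state z (q + L) = a"
    "block (\<pi> z) p (length (between (\<pi> x) p q)) = between (\<pi> x) p q"
    using T_realize[OF b, of p] unfolding len by blast
  have ag: "\<pi> z k = \<pi> x k" if "p \<le> k" "k < q + L" for k
    using arg_cong[OF z(3), of "\<lambda>l. l ! nat (k - p)"] that unfolding between_def by simp
  have o: "w_at (\<pi> z) q" by (rule w_at_agree[OF x(3)]) (use ag x(4) in simp)
  have "a \<in> mark_at z q" using o w_at_e[OF z(1) o] a(1) z(2) by (simp add: mark_at_def mark_def)
  then have "mark_at z q = C" using o a(2) mark_self by (simp add: mark_at_def)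
  then show ?thesis using z(1) ag by blast
qed

text \<open>The right-hand version up to the occurrence at \<open>i\<close> and the left-hand
  version from there on produce two points with the same mark at \<open>i\<close>, which are
  joined by rerouting.\<close>

lemma mark_realized_middle:
  assumes x: "x \<in> X" "w_at (\<pi> x) p" "w_at (\<pi> x) i" "w_at (\<pi> x) q" "p + L \<le> i" "i + L \<le> q" and C: "C \<in> marks"
  shows "\<exists>z\<in>X. mark_at z i = C \<and> (\<forall>k. p \<le> k \<longrightarrow> k < q + L \<longrightarrow> \<pi> z k = \<pi> x k)"
proof -
  obtain x1 where x1: "x1 \<in> X" "mark_at x1 i = C" "\<And>k. p \<le> k \<Longrightarrow> k < i + L \<Longrightarrow> \<pi> x1 k = \<pi> x k"
    using mark_realized_right[OF x(1,2,3,5) C] by blast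
  obtain x2 where x2: "x2 \<in> X" "mark_at x2 i = C" "\<And>k. i \<le> k \<Longrightarrow> k < q + L \<Longrightarrow> \<pi> x2 k = \<pi> x k"
    using mark_realized_left[OF x(1,3,4,6) C] by blast
  have o: "w_at (\<pi> x1) i" by (rule w_at_agree[OF x(3)]) (use x1(3) x(5) in simp)
  have o2: "w_at (\<pi> x2) i" by (rule w_at_agree[OF x(3)]) (use x2(3) x(6) in simp)
  have "mark_at x1 i = mark_at x2 i" using x1(2) x2(2) by simp
  from reroute[OF x1(1) x2(1) o o2 this] obtain z where z: "z \<in> X" "\<forall>j\<le>i. state z j = state x1 j"
    "\<forall>j\<ge>i + L. state z j = state x2 j" "w_at (\<pi> z) i" "mark_at z i = mark_at x1 i" by blast
  have "\<pi> z k = \<pi> x k" if k: "p \<le> k" "k < q + L" for k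
  proof -
    consider "k < i" | "k \<ge> i" "k < i + L" | "k \<ge> i + L" by linarith
    then show ?thesis
    proof cases
      case 1
      then have "\<pi> z k = \<pi> x1 k" by (intro image_state z(1) x1(1)) (simp add: z(2))
      then show ?thesis using x1(3)[of k] 1 k by simp
    next
      case 2
      have "block (\<pi> z) i (length w) ! nat (k - i) = block (\<pi> x) i (length w) ! nat (k - i)"
        using z(4) x(3) by (simp add: w_at_def)
      then show ?thesis using 2 by simp
    next
      case 3
      then have "\<pi> z k = \<pi> x2 k" by (intro image_state z(1) x2(1)) (simp add: z(3))
      then show ?thesis using x2(3)[of k] 3 k by simp
    qed
  qed
  then show ?thesis using z(1,5) x1(2) by auto
qed

text \<open>Two occurrences of \<open>w\<close> may overlap, so their marks are compared through a
  third one far away, disjoint from both.\<close>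

lemma mark_at_determined_everywhere:
  assumes x: "x \<in> X" "x' \<in> X" "\<pi> x = \<pi> x'" and m: "w_at (\<pi> x) i" "mark_at x i = mark_at x' i"
    and inf: "(\<forall>n. \<exists>q\<ge>n. w_at (\<pi> x) q) \<or> (\<forall>n. \<exists>q\<le>n. w_at (\<pi> x) q)"
  shows "mark_at x = mark_at x'"
proof
  fix j
  show "mark_at x j = mark_at x' j"
  proof (cases "w_at (\<pi> x) j")
    case False
    then show ?thesis using x(3) by (simp add: mark_at_def)
  next
    case True
    have d: "mark_at x p = mark_at x' p \<longleftrightarrow> mark_at x q = mark_at x' q" if "w_at (\<pi> x) p" "w_at (\<pi> x) q" "p + L \<le> q" for p q
      by (rule mark_at_determined[OF x(1,2) that]) (simp add: x(3))
    from inf show ?thesis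
    proof
      assume "\<forall>n. \<exists>q\<ge>n. w_at (\<pi> x) q"
      then obtain q where "q \<ge> max i j + L" "w_at (\<pi> x) q" by blast
      then show ?thesis using d[of i q] d[of j q] True m by simp
    next
      assume "\<forall>n. \<exists>q\<le>n. w_at (\<pi> x) q"
      then obtain q where "q \<le> min i j - L" "w_at (\<pi> x) q" by blast
      then show ?thesis using d[of q i] d[of q j] True m by simp
    qed
  qed
qed

text \<open>With finitely many occurrences of \<open>w\<close> there are finitely many decorations
  to choose from; with infinitely many, a single mark fixes all the others.\<close>

lemma finite_mark_sequences: "finite (mark_at ` fibre \<pi> X y)"
proof (cases "finite {i. w_at y i}")
  case True
  have "mark_at ` fibre \<pi> X y \<subseteq> {f. \<forall>i. (i \<in> {i. w_at y i} \<longrightarrow> f i \<in> marks) \<and> (i \<notin> {i. w_at y i} \<longrightarrow> f i = {})}"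
    using mark_at_in_marks by (auto simp: fibre_def mark_at_def)
  then show ?thesis by (rule finite_subset) (rule finite_set_of_finite_funs[OF True finite_marks])
next
  case False
  then obtain i where i: "w_at y i" by fastforce
  have inf: "(\<forall>n. \<exists>q\<ge>n. w_at y q) \<or> (\<forall>n. \<exists>q\<le>n. w_at y q)"
  proof (rule ccontr)
    assume "\<not> ((\<forall>n. \<exists>q\<ge>n. w_at y q) \<or> (\<forall>n. \<exists>q\<le>n. w_at y q))"
    then obtain m n where mn: "\<forall>q\<ge>m. \<not> w_at y q" "\<forall>q\<le>n. \<not> w_at y q" by auto
    have "{i. w_at y i} \<subseteq> {n..m}"
    proof
      fix q assume "q \<in> {i. w_at y i}"
      then have "\<not> q \<ge> m" "\<not> q \<le> n" using mn by auto
      then show "q \<in> {n..m}" by simp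
    qed
    then show False using False finite_subset[OF _ finite_atLeastAtMost_int] by simp
  qed
  have "inj_on (\<lambda>f. f i) (mark_at ` fibre \<pi> X y)"
  proof (rule inj_onI)
    fix f g assume "f \<in> mark_at ` fibre \<pi> X y" "g \<in> mark_at ` fibre \<pi> X y" "f i = g i"
    then obtain x x' where x: "x \<in> X" "x' \<in> X" "\<pi> x = y" "\<pi> x' = y" "f = mark_at x" "g = mark_at x'" "mark_at x i = mark_at x' i"
      by (auto simp: fibre_def)
    then show "f = g" using mark_at_determined_everywhere[of x x' i] i inf by simp
  qed
  moreover have "(\<lambda>f. f i) ` (mark_at ` fibre \<pi> X y) \<subseteq> marks"
    using i mark_at_in_marks by (auto simp: fibre_def)
  then have "finite ((\<lambda>f. f i) ` (mark_at ` fibre \<pi> X y))" by (rule finite_subset) (rule finite_marks)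
  ultimately show ?thesis by (rule finite_imageD[rotated])
qed

definition recurrent :: "(int \<Rightarrow> 'b) \<Rightarrow> bool" where
  "recurrent y \<longleftrightarrow> (\<forall>n. \<exists>q\<ge>n. w_at y q) \<and> (\<forall>n. \<exists>q\<le>n. w_at y q)"

text \<open>Every mark is realized over arbitrarily long windows of the image, by
  \<open>mark_realized_middle\<close> between two far away occurrences, and the mark survives in a
  cluster point because it depends on a finite window.\<close>

lemma mark_realized:
  assumes x: "x \<in> X" "recurrent (\<pi> x)" and i: "w_at (\<pi> x) i" and C: "C \<in> marks"
  shows "\<exists>z\<in>X. \<pi> z = \<pi> x \<and> mark_at z i = C"
proof -
  have "\<exists>z. z \<in> X \<and> mark_at z i = C \<and> (\<forall>k. \<bar>k\<bar> \<le> int n \<longrightarrow> \<pi> z k = \<pi> x k)" for n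
  proof -
    \<comment> \<open>occurrences that are disjoint from the one at \<open>i\<close> and enclose the window of radius \<open>n\<close>\<close>
    obtain p where p: "p \<le> min (i - L) (- int n)" "w_at (\<pi> x) p" using x(2) unfolding recurrent_def by blast
    obtain q where q: "q \<ge> max (i + L) (int n + 1)" "w_at (\<pi> x) q" using x(2) unfolding recurrent_def by blast
    have "p + L \<le> i" "i + L \<le> q" using p q by simp_all
    from mark_realized_middle[OF x(1) p(2) i q(2) this C] obtain z where
      z: "z \<in> X" "mark_at z i = C" "\<forall>k. p \<le> k \<longrightarrow> k < q + L \<longrightarrow> \<pi> z k = \<pi> x k" by blast
    have "\<pi> z k = \<pi> x k" if "\<bar>k\<bar> \<le> int n" for k
    proof -
      have "p \<le> k" "k < q + L" using p(1) q(1) that by linarith+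
      then show ?thesis using z(3) by simp
    qed
    then show ?thesis using z(1,2) by blast
  qed
  then have "\<forall>n. \<exists>z. z \<in> X \<and> mark_at z i = C \<and> (\<forall>k. \<bar>k\<bar> \<le> int n \<longrightarrow> \<pi> z k = \<pi> x k)" by simp
  from choice[OF this] obtain f where
    f: "\<And>n. f n \<in> X" "\<And>n. mark_at (f n) i = C" "\<And>n k. \<bar>k\<bar> \<le> int n \<Longrightarrow> \<pi> (f n) k = \<pi> x k" by auto
  obtain A where A: "finite A" "\<forall>x\<in>X. range x \<subseteq> A" using shift_space_alphabet[OF shift_space] by blast
  obtain z where z: "\<forall>n. \<exists>m\<ge>n. agree n z (f m)"
    using cluster_point[OF A(1) bspec[OF A(2) f(1)]] ..
  have zX: "z \<in> X" using z f(1) by (intro shift_space_limit[OF shift_space]) blast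
  have st: "\<exists>m\<ge>n. \<forall>k. \<bar>k\<bar> \<le> int n \<longrightarrow> state z k = state (f m) k" for n
  proof -
    obtain m where m: "m \<ge> n + N" "agree (n + N) z (f m)" using z by blast
    then have "state z k = state (f m) k" if "\<bar>k\<bar> \<le> int n" for k
      using that unfolding state_eq_iff agree_def by auto
    then show ?thesis using m(1) by (intro exI[of _ m]) simp
  qed
  have "\<pi> z k = \<pi> x k" for k
  proof -
    obtain m where m: "m \<ge> nat \<bar>k\<bar>" "\<forall>j. \<bar>j\<bar> \<le> int (nat \<bar>k\<bar>) \<longrightarrow> state z j = state (f m) j" using st by blast
    then have "\<pi> z k = \<pi> (f m) k" by (intro image_state zX f(1)) simp
    then show ?thesis using f(3)[of k m] m(1) by simp
  qed
  then have \<pi>z: "\<pi> z = \<pi> x" by blast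
  let ?n = "nat (\<bar>i\<bar> + L)"
  obtain m where m: "m \<ge> ?n" "\<forall>j. \<bar>j\<bar> \<le> int ?n \<longrightarrow> state z j = state (f m) j" using st by blast
  have "w_at (\<pi> (f m)) i"
    by (rule w_at_agree[OF i]) (rule f(3)[symmetric], use m(1) in linarith)
  then have "mark_at z i = mark_at (f m) i" using i m(2) by (intro mark_at_cong) (simp_all add: \<pi>z)
  then show ?thesis using zX \<pi>z f(2) by blast
qed

lemma card_mark_sequences:
  assumes "x \<in> X" "\<pi> x = y" "recurrent y"
  shows "card (mark_at ` fibre \<pi> X y) = card marks"
proof -
  obtain i where i: "w_at y i" using assms(3) unfolding recurrent_def by blast
  have "inj_on (\<lambda>f. f i) (mark_at ` fibre \<pi> X y)"
  proof (rule inj_onI)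
    fix f g assume "f \<in> mark_at ` fibre \<pi> X y" "g \<in> mark_at ` fibre \<pi> X y" "f i = g i"
    then obtain x x' where x: "x \<in> X" "x' \<in> X" "\<pi> x = y" "\<pi> x' = y" "f = mark_at x" "g = mark_at x'" "mark_at x i = mark_at x' i"
      by (auto simp: fibre_def)
    then show "f = g" using mark_at_determined_everywhere[of x x' i] i assms(3) by (simp add: recurrent_def)
  qed
  moreover have "(\<lambda>f. f i) ` (mark_at ` fibre \<pi> X y) = marks"
  proof (intro equalityI subsetI)
    fix C assume "C \<in> marks"
    then obtain z where "z \<in> X" "\<pi> z = y" "mark_at z i = C"
      using mark_realized[of x i C] assms i by blast
    then show "C \<in> (\<lambda>f. f i) ` (mark_at ` fibre \<pi> X y)" by (force simp: fibre_def)
  qed (use i mark_at_in_marks in \<open>auto simp: fibre_def\<close>)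
  ultimately show ?thesis using card_image by metis
qed

end

section \<open>Transition classes\<close>

lemma transition_refl: "x \<in> X \<Longrightarrow> transition \<pi> X x x"
  unfolding transition_def fibre_def
  by (intro conjI allI bexI[of _ x] exI[of _ "int _ + 1"]) auto

lemma transition_equiv_class_subset:
  "transition_equiv \<pi> X `` {x} \<subseteq> fibre \<pi> X (\<pi> x)"
  unfolding transition_equiv_def transition_def fibre_def by auto

text \<open>A class contains the point that it is formed from, and lies in the fibre of that
  point.\<close>

lemma transition_classes_over_eq:
  "transition_classes_over \<pi> X y = (\<lambda>x. transition_equiv \<pi> X `` {x}) ` fibre \<pi> X y"
proof (intro equalityI subsetI)
  fix C assume "C \<in> transition_classes_over \<pi> X y"
  then obtain x where x: "x \<in> X" "C = transition_equiv \<pi> X `` {x}" "C \<subseteq> fibre \<pi> X y"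
    unfolding transition_classes_over_def quotient_def by blast
  have "x \<in> C" unfolding x(2) transition_equiv_def using transition_refl[OF x(1)] by simp
  then have "x \<in> fibre \<pi> X y" using x(3) by blast
  then show "C \<in> (\<lambda>x. transition_equiv \<pi> X `` {x}) ` fibre \<pi> X y" using x(2) by blast
next
  fix C assume "C \<in> (\<lambda>x. transition_equiv \<pi> X `` {x}) ` fibre \<pi> X y"
  then obtain x where "x \<in> X" "\<pi> x = y" "C = transition_equiv \<pi> X `` {x}" unfolding fibre_def by auto
  then show "C \<in> transition_classes_over \<pi> X y"
    unfolding transition_classes_over_def using transition_equiv_class_subset[of \<pi> X x]
    by (auto intro: quotientI)
qed

lemma card_image_factor_le:
  assumes "finite (h ` F)" "\<And>x x'. x \<in> F \<Longrightarrow> x' \<in> F \<Longrightarrow> h x = h x' \<Longrightarrow> g x = g x'"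
  shows "finite (g ` F)" "card (g ` F) \<le> card (h ` F)"
proof -
  have "g x = g (inv_into F h (h x))" if "x \<in> F" for x
    using that by (intro assms(2) inv_into_into) (simp_all add: f_inv_into_f)
  then have eq: "g ` F = (\<lambda>m. g (inv_into F h m)) ` (h ` F)" by (simp add: image_image)
  show "finite (g ` F)" "card (g ` F) \<le> card (h ` F)"
    unfolding eq using assms(1) by (auto intro: card_image_le)
qed

text \<open>If all transitions are possible within one fibre then this fibre is a single class,
  and no fibre has zero classes.\<close>

lemma class_degree_1:
  assumes Y: "Y = \<phi> ` X" and x0: "x0 \<in> X"
    and tr: "\<And>x x'. x \<in> X \<Longrightarrow> x' \<in> X \<Longrightarrow> \<phi> x = \<phi> x0 \<Longrightarrow> \<phi> x' = \<phi> x0 \<Longrightarrow> transition \<phi> X x x'"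
  shows "class_degree \<phi> X Y = 1"
  unfolding class_degree_def
proof (rule Least_equality)
  have cl: "transition_equiv \<phi> X `` {x} = fibre \<phi> X (\<phi> x0)" if "x \<in> fibre \<phi> X (\<phi> x0)" for x
  proof
    show "transition_equiv \<phi> X `` {x} \<subseteq> fibre \<phi> X (\<phi> x0)"
      using transition_equiv_class_subset[of \<phi> X x] that by (simp add: fibre_def)
    show "fibre \<phi> X (\<phi> x0) \<subseteq> transition_equiv \<phi> X `` {x}"
      using that tr by (auto simp: fibre_def transition_equiv_def)
  qed
  have "x0 \<in> fibre \<phi> X (\<phi> x0)" using x0 by (simp add: fibre_def)
  then have "transition_classes_over \<phi> X (\<phi> x0) = {fibre \<phi> X (\<phi> x0)}"
    unfolding transition_classes_over_eq using cl by auto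
  then show "\<exists>y\<in>Y. finite (transition_classes_over \<phi> X y) \<and> card (transition_classes_over \<phi> X y) = 1"
    using Y x0 by (intro bexI[of _ "\<phi> x0"]) simp_all
next
  fix c assume "\<exists>y\<in>Y. finite (transition_classes_over \<phi> X y) \<and> card (transition_classes_over \<phi> X y) = c"
  then obtain x where x: "x \<in> X" "finite (transition_classes_over \<phi> X (\<phi> x))" "card (transition_classes_over \<phi> X (\<phi> x)) = c"
    unfolding Y by blast
  have "transition_classes_over \<phi> X (\<phi> x) \<noteq> {}"
    unfolding transition_classes_over_eq using x(1) by (auto simp: fibre_def)
  then show "1 \<le> c" using x(2,3) by (metis One_nat_def Suc_leI card_gt_0_iff)
qed

context factor_setup begin

text \<open>The first connecting point has reached \<open>x'\<close> from \<open>i1\<close> on.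
  The second is chosen to follow \<open>x'\<close> until \<open>i1 + 2 * N\<close>, so the two
  share the state at \<open>i1 + N\<close> and are spliced there.\<close>

lemma transition_trans:
  assumes t: "transition \<pi> X x x'" "transition \<pi> X x' x''"
  shows "transition \<pi> X x x''"
proof -
  have X: "x \<in> X" "x'' \<in> X" "\<pi> x = \<pi> x'" "\<pi> x' = \<pi> x''" using t by (simp_all add: transition_def)
  have "\<exists>z\<in>fibre \<pi> X (\<pi> x). (\<forall>j\<le>int n. z j = x j) \<and> (\<exists>i>int n. \<forall>j\<ge>i. z j = x'' j)" for n
  proof -
    obtain z1 i1 where z1: "z1 \<in> X" "\<pi> z1 = \<pi> x" "\<forall>j\<le>int n. z1 j = x j" "i1 > int n" "\<forall>j\<ge>i1. z1 j = x' j"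
      using t(1) unfolding transition_def fibre_def by fastforce
    define m where "m = i1 + int N"
    define n' where "n' = nat (m + int N)"
    have n': "int n' = m + int N" using z1(4) by (simp add: n'_def m_def)
    obtain z2 i2 where z2: "z2 \<in> X" "\<pi> z2 = \<pi> x" "\<forall>j\<le>int n'. z2 j = x' j" "i2 > int n'" "\<forall>j\<ge>i2. z2 j = x'' j"
      using t(2) X(3) unfolding transition_def fibre_def by fastforce
    have "state z1 m = state z2 m"
      unfolding state_eq_iff using z1(5) z2(3) n' by (simp add: m_def)
    from splice_states[OF z1(1) z2(1) this] obtain z where
      z: "z \<in> X" "\<forall>j\<le>m. state z j = state z1 j" "\<forall>j\<ge>m. state z j = state z2 j" by blast
    have "\<pi> z k = \<pi> x k" for k
    proof (cases "k \<le> m")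
      case True
      then show ?thesis using image_state[OF z(1) z1(1), of k k] z(2) z1(2) by simp
    next
      case False
      then show ?thesis using image_state[OF z(1) z2(1), of k k] z(3) z2(2) by simp
    qed
    then have "z \<in> fibre \<pi> X (\<pi> x)" using z(1) by (auto simp: fibre_def)
    moreover have "\<forall>j\<le>int n. z j = x j"
    proof (intro allI impI)
      fix j assume "j \<le> int n"
      then have "state z j = state z1 j" using z(2) z1(4) by (simp add: m_def)
      then show "z j = x j" using state_symbol z1(3) \<open>j \<le> int n\<close> by metis
    qed
    moreover have "\<forall>j\<ge>i2. z j = x'' j"
    proof (intro allI impI)
      fix j assume "j \<ge> i2"
      then have "state z j = state z2 j" using z(3) z2(4) n' by simp
      then show "z j = x'' j" using state_symbol z2(5) \<open>j \<ge> i2\<close> by metis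
    qed
    moreover have "i2 > int n" using z2(4) n' z1(4) by (simp add: m_def)
    ultimately show ?thesis by blast
  qed
  then show ?thesis unfolding transition_def using X by simp
qed

lemma equiv_transition_equiv: "equiv X (transition_equiv \<pi> X)"
proof (rule equivI)
  show "transition_equiv \<pi> X \<subseteq> X \<times> X" by (auto simp: transition_equiv_def transition_def)
  show "refl_on X (transition_equiv \<pi> X)"
    by (intro refl_onI) (simp_all add: transition_equiv_def transition_refl)
  show "sym (transition_equiv \<pi> X)" by (auto intro: symI simp: transition_equiv_def)
  show "trans (transition_equiv \<pi> X)"
  proof (rule transI)
    fix x y z assume "(x, y) \<in> transition_equiv \<pi> X" "(y, z) \<in> transition_equiv \<pi> X"
    then have "transition \<pi> X x y" "transition \<pi> X y x" "transition \<pi> X y z" "transition \<pi> X z y"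
      by (simp_all add: transition_equiv_def)
    then have "transition \<pi> X x z" "transition \<pi> X z x"
      using transition_trans[of x y z] transition_trans[of z y x] by simp_all
    then show "(x, z) \<in> transition_equiv \<pi> X" by (simp add: transition_equiv_def)
  qed
qed

end

context marked_setup begin

text \<open>The rerouted point has the marks of \<open>x\<close> everywhere since it has one of
  them and the same image. Keeping the marks makes this usable for the decorated factor code as
  well as for \<open>\<pi>\<close>.\<close>

lemma same_marks_transition:
  assumes x: "x \<in> X" "x' \<in> X" "\<pi> x = \<pi> x'" "mark_at x = mark_at x'" and rec: "recurrent (\<pi> x)"
  shows "\<exists>z\<in>X. \<pi> z = \<pi> x \<and> mark_at z = mark_at x \<and> (\<forall>j\<le>int n. z j = x j) \<and> (\<exists>i>int n. \<forall>j\<ge>i. z j = x' j)"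
proof -
  obtain q where q: "q \<ge> int n" "w_at (\<pi> x) q" using rec unfolding recurrent_def by blast
  have "w_at (\<pi> x') q" "mark_at x q = mark_at x' q" using q x(3,4) by simp_all
  from reroute[OF x(1,2) q(2) this] obtain z where z: "z \<in> X" "\<forall>j\<le>q. state z j = state x j"
    "\<forall>j\<ge>q + L. state z j = state x' j" "w_at (\<pi> z) q" "mark_at z q = mark_at x q" by blast
  have \<pi>z: "\<pi> z k = \<pi> x k" for k
  proof -
    consider "k < q" | "k \<ge> q" "k < q + L" | "k \<ge> q + L" by linarith
    then show ?thesis
    proof cases
      case 1
      then show ?thesis by (intro image_state z(1) x(1)) (simp add: z(2))
    next
      case 2
      have "block (\<pi> z) q (length w) ! nat (k - q) = block (\<pi> x) q (length w) ! nat (k - q)"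
        using z(4) q(2) by (simp add: w_at_def)
      then show ?thesis using 2 by simp
    next
      case 3
      then have "\<pi> z k = \<pi> x' k" by (intro image_state z(1) x(2)) (simp add: z(3))
      then show ?thesis using x(3) by simp
    qed
  qed
  then have \<pi>eq: "\<pi> z = \<pi> x" by blast
  have "mark_at x = mark_at z"
    by (rule mark_at_determined_everywhere[OF x(1) z(1) \<pi>eq[symmetric] q(2) z(5)[symmetric]])
      (use rec in \<open>simp add: recurrent_def\<close>)
  moreover have "\<forall>j\<le>int n. z j = x j"
    using q(1) z(2) state_symbol by (metis order_trans)
  moreover have "\<forall>j\<ge>q + L + 1. z j = x' j"
  proof (intro allI impI)
    fix j assume "j \<ge> q + L + 1"
    then have "state z j = state x' j" using z(3) by simp
    then show "z j = x' j" by (rule state_symbol)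
  qed
  moreover have "q + L + 1 > int n" using q(1) by simp
  ultimately show ?thesis using z(1) \<pi>eq by (intro bexI[of _ z] conjI exI[of _ "q + L + 1"]) simp_all
qed

lemma transition_classes_recurrent_le:
  assumes "recurrent y"
  shows "finite (transition_classes_over \<pi> X y)" "card (transition_classes_over \<pi> X y) \<le> card (mark_at ` fibre \<pi> X y)"
proof -
  have *: "transition \<pi> X x x'" if "x \<in> fibre \<pi> X y" "x' \<in> fibre \<pi> X y" "mark_at x = mark_at x'" for x x'
  proof -
    have x: "x \<in> X" "x' \<in> X" "\<pi> x = \<pi> x'" "recurrent (\<pi> x)" using that assms by (simp_all add: fibre_def)
    show ?thesis
      unfolding transition_def fibre_def using same_marks_transition[OF x(1-3) that(3) x(4)] x by blast
  qed
  have "transition_equiv \<pi> X `` {x} = transition_equiv \<pi> X `` {x'}"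
    if "x \<in> fibre \<pi> X y" "x' \<in> fibre \<pi> X y" "mark_at x = mark_at x'" for x x'
  proof (rule equiv_class_eq[OF equiv_transition_equiv])
    show "(x, x') \<in> transition_equiv \<pi> X"
      unfolding transition_equiv_def using *[OF that] *[OF that(2,1) that(3)[symmetric]] by simp
  qed
  note le = card_image_factor_le[OF finite_mark_sequences this]
  show "finite (transition_classes_over \<pi> X y)" "card (transition_classes_over \<pi> X y) \<le> card (mark_at ` fibre \<pi> X y)"
    unfolding transition_classes_over_eq by (rule le, assumption+)+
qed

definition linked :: "(int \<Rightarrow> 'b) \<Rightarrow> 'a list \<Rightarrow> int \<Rightarrow> 'a list \<Rightarrow> int \<Rightarrow> bool" where
  "linked y s i t j \<longleftrightarrow> (\<exists>r\<in>X. state r i = s \<and> state r j = t \<and> (\<forall>k. i \<le> k \<longrightarrow> k < j \<longrightarrow> \<pi> r k = y k))"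

text \<open>The word \<open>w\<close> may fail to occur in the image of \<open>x0\<close>.
  Irreducibility still places any window of \<open>x0\<close> between two occurrences of
  \<open>w\<close>.\<close>

lemma embed_between_marks:
  assumes x0: "x0 \<in> X"
  shows "\<exists>x\<in>X. \<exists>p q. w_at (\<pi> x) p \<and> w_at (\<pi> x) q \<and> p + L \<le> - int n \<and> int n < q \<and>
    (\<forall>k. \<bar>k\<bar> \<le> int n \<longrightarrow> \<pi> x k = \<pi> x0 k)"
proof -
  obtain s t where st: "(s, t) \<in> e" using e_nonempty by auto
  define M where "M = 2 * n + 1"
  define v where "v = block (\<pi> x0) (- int n) M"
  let ?s' = "state x0 (- int n)" and ?t' = "state x0 (- int n + int M)"
  have S: "s \<in> S" "t \<in> S" "?s' \<in> S" "?t' \<in> S" using st T_subset[of w] state_in_S[OF x0] by auto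
  obtain u u' where u: "(t, ?s') \<in> T u" "(?t', s) \<in> T u'" using T_connect S by blast
  have v: "(?s', ?t') \<in> T v" unfolding v_def by (rule T_block[OF x0])
  have "(s, t) \<in> T (w @ u @ v @ u' @ w)" unfolding T_append using st u v by blast
  \<comment> \<open>with this start the window of \<open>x0\<close> comes to lie at its own position \<open>- n\<close>\<close>
  define p where "p = - int n - int (length u) - L"
  from T_realize[OF \<open>(s, t) \<in> T (w @ u @ v @ u' @ w)\<close>, of p] obtain x where x: "x \<in> X"
    "block (\<pi> x) p (length (w @ u @ v @ u' @ w)) = w @ u @ v @ u' @ w" by blast
  define q where "q = int n + 1 + int (length u')"
  have len: "length (w @ u @ v @ u' @ w) = length w + (length u + (M + (length u' + length w)))"
    by (simp add: v_def)
  have pos: "p + L + int (length u) = - int n" "- int n + int M + int (length u') = q"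
    by (simp_all add: p_def q_def M_def)
  have "block (\<pi> x) p (length w) @ block (\<pi> x) (p + L) (length u) @ block (\<pi> x) (- int n) M @
     block (\<pi> x) (- int n + int M) (length u') @ block (\<pi> x) q (length w) = w @ u @ v @ u' @ w"
    using x(2) unfolding len block_append pos .
  then have "w_at (\<pi> x) p" "block (\<pi> x) (- int n) M = v" "w_at (\<pi> x) q"
    unfolding w_at_def by (auto simp: v_def)
  moreover have "\<pi> x k = \<pi> x0 k" if "\<bar>k\<bar> \<le> int n" for k
  proof -
    have "nat (k + int n) < M" "int (nat (k + int n)) = k + int n" using that by (auto simp: M_def)
    then show ?thesis using arg_cong[OF calculation(2), of "\<lambda>l. l ! nat (k + int n)"] by (simp add: v_def)
  qed
  moreover have "p + L \<le> - int n" "int n < q" by (simp_all add: p_def q_def)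
  ultimately show ?thesis using x(1) by blast
qed

text \<open>The tracks realize the different marks at the left occurrence. A link from the track
  of \<open>C\<close> to that of \<open>D\<close> would be spliced to a point that has mark
  \<open>C\<close> on the left but shares the mark of the track of \<open>D\<close> on the right,
  although the right mark determines the left one.\<close>

lemma unlinked_tracks_window:
  assumes x0: "x0 \<in> X"
  shows "\<exists>t. (\<forall>C\<in>marks. t C \<in> X \<and> (\<forall>k. \<bar>k\<bar> \<le> int n \<longrightarrow> \<pi> (t C) k = \<pi> x0 k)) \<and>
    (\<forall>C\<in>marks. \<forall>D\<in>marks. C \<noteq> D \<longrightarrow> (\<forall>i j. - int n \<le> i \<longrightarrow> i \<le> j \<longrightarrow> j \<le> int n \<longrightarrow>
       \<not> linked (\<pi> x0) (state (t C) i) i (state (t D) j) j))"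
proof -
  obtain x p q where x: "x \<in> X" "w_at (\<pi> x) p" "w_at (\<pi> x) q" "p + L \<le> - int n" "int n < q"
    "\<forall>k. \<bar>k\<bar> \<le> int n \<longrightarrow> \<pi> x k = \<pi> x0 k" using embed_between_marks[OF x0] by blast
  have pq: "p + L \<le> q" using x(4,5) by simp
  have "\<forall>C\<in>marks. \<exists>z\<in>X. mark_at z p = C \<and> (\<forall>k. p \<le> k \<longrightarrow> k < q + L \<longrightarrow> \<pi> z k = \<pi> x k)"
    using mark_realized_left[OF x(1-3) pq] by blast
  from bchoice[OF this[unfolded Bex_def]] obtain t where
    t: "\<And>C. C \<in> marks \<Longrightarrow> t C \<in> X" "\<And>C. C \<in> marks \<Longrightarrow> mark_at (t C) p = C"
      "\<And>C k. C \<in> marks \<Longrightarrow> p \<le> k \<Longrightarrow> k < q + L \<Longrightarrow> \<pi> (t C) k = \<pi> x k" by auto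
  have "\<pi> (t C) k = \<pi> x0 k" if "C \<in> marks" "\<bar>k\<bar> \<le> int n" for C k
  proof -
    have "p \<le> k" "k < q + L" using that(2) x(4,5) by linarith+
    then show ?thesis using t(3) that x(6) by simp
  qed
  moreover have False
    if CD: "C \<in> marks" "D \<in> marks" "C \<noteq> D" and ij: "- int n \<le> i" "i \<le> j" "j \<le> int n"
      and li: "linked (\<pi> x0) (state (t C) i) i (state (t D) j) j" for C D i j
  proof -
    obtain r where r: "r \<in> X" "state r i = state (t C) i" "state r j = state (t D) j"
      "\<forall>k. i \<le> k \<longrightarrow> k < j \<longrightarrow> \<pi> r k = \<pi> x0 k"
      using li unfolding linked_def by blast
    obtain z1 where z1: "z1 \<in> X" "\<forall>k\<le>i. state z1 k = state (t C) k" "\<forall>k\<ge>i. state z1 k = state r k"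
      using splice_states[OF t(1)[OF CD(1)] r(1) r(2)[symmetric]] by blast
    have "state z1 j = state (t D) j" using z1(3) ij(2) r(3) by simp
    from splice_states[OF z1(1) t(1)[OF CD(2)] this] obtain z where
      z: "z \<in> X" "\<forall>k\<le>j. state z k = state z1 k" "\<forall>k\<ge>j. state z k = state (t D) k" by blast
    have \<pi>z: "\<pi> z k = \<pi> x k" if k: "p \<le> k" "k < q + L" for k
    proof -
      consider "k < i" | "i \<le> k" "k < j" | "j \<le> k" by linarith
      then show ?thesis
      proof cases
        case 1
        then have "\<pi> z k = \<pi> (t C) k" using ij(2) by (intro image_state z(1) t(1) CD(1)) (simp add: z(2) z1(2))
        then show ?thesis using t(3)[OF CD(1) k] by simp
      next
        case 2
        then have "\<pi> z k = \<pi> r k" by (intro image_state z(1) r(1)) (simp add: z(2) z1(3))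
        moreover have "\<bar>k\<bar> \<le> int n" using 2 ij by simp
        ultimately show ?thesis using r(4) x(6) 2 by simp
      next
        case 3
        then have "\<pi> z k = \<pi> (t D) k" by (intro image_state z(1) t(1) CD(2)) (simp add: z(3))
        then show ?thesis using t(3)[OF CD(2) k] by simp
      qed
    qed
    have oz: "w_at (\<pi> z) p" "w_at (\<pi> z) q"
      by (rule w_at_agree[OF x(2)], use \<pi>z pq in simp) (rule w_at_agree[OF x(3)], use \<pi>z pq in simp)
    have oC: "w_at (\<pi> (t C)) p" by (rule w_at_agree[OF x(2)]) (use t(3)[OF CD(1)] pq in simp)
    have oD: "w_at (\<pi> (t D)) q" by (rule w_at_agree[OF x(3)]) (use t(3)[OF CD(2)] pq in simp)
    have "mark_at z p = mark_at (t C) p" using oz oC x(4) ij by (intro mark_at_cong) (simp_all add: z(2) z1(2))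
    moreover have "mark_at z q = mark_at (t D) q" using oz oD x(5) ij by (intro mark_at_cong) (simp_all add: z(3))
    then have "mark_at z p = mark_at (t D) p"
      using mark_at_determined[OF z(1) t(1)[OF CD(2)] oz pq] \<pi>z t(3)[OF CD(2)] by simp
    ultimately show False using t(2) CD by simp
  qed
  ultimately show ?thesis using t(1) by (intro exI[of _ t]) blast
qed

text \<open>The tracks over growing windows are bundled into one sequence over the finite alphabet
  of functions from marks to symbols, and a cluster point of these bundles is taken. Links are a
  matter of two states, so they cannot appear in the limit.\<close>

lemma unlinked_tracks:
  assumes x0: "x0 \<in> X"
  shows "\<exists>t. (\<forall>C\<in>marks. t C \<in> fibre \<pi> X (\<pi> x0)) \<and>
    (\<forall>C\<in>marks. \<forall>D\<in>marks. C \<noteq> D \<longrightarrow> (\<forall>i j. i \<le> j \<longrightarrow>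
       \<not> linked (\<pi> x0) (state (t C) i) i (state (t D) j) j))"
proof -
  define P where "P n t \<longleftrightarrow> (\<forall>C\<in>marks. t C \<in> X \<and> (\<forall>k. \<bar>k\<bar> \<le> int n \<longrightarrow> \<pi> (t C) k = \<pi> x0 k)) \<and>
    (\<forall>C\<in>marks. \<forall>D\<in>marks. C \<noteq> D \<longrightarrow> (\<forall>i j. - int n \<le> i \<longrightarrow> i \<le> j \<longrightarrow> j \<le> int n \<longrightarrow>
       \<not> linked (\<pi> x0) (state (t C) i) i (state (t D) j) j))" for n and t :: "'a list set \<Rightarrow> int \<Rightarrow> 'a"
  have "\<forall>n. \<exists>t. P n t" unfolding P_def using unlinked_tracks_window[OF x0] by simp
  from choice[OF this] obtain t where t: "\<And>n. P n (t n)" by auto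
  have tX: "\<And>n C. C \<in> marks \<Longrightarrow> t n C \<in> X"
    and t\<pi>: "\<And>n C k. C \<in> marks \<Longrightarrow> \<bar>k\<bar> \<le> int n \<Longrightarrow> \<pi> (t n C) k = \<pi> x0 k"
    and tl: "\<And>n C D i j. C \<in> marks \<Longrightarrow> D \<in> marks \<Longrightarrow> C \<noteq> D \<Longrightarrow> - int n \<le> i \<Longrightarrow> i \<le> j \<Longrightarrow> j \<le> int n \<Longrightarrow>
       \<not> linked (\<pi> x0) (state (t n C) i) i (state (t n D) j) j"
    using t unfolding P_def by simp_all
  obtain A where A: "finite A" "\<forall>x\<in>X. range x \<subseteq> A" using shift_space_alphabet[OF shift_space] by blast
  \<comment> \<open>the value outside \<open>marks\<close> keeps the bundles in a finite set of functions\<close>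
  define g where "g n i = (\<lambda>C. if C \<in> marks then t n C i else undefined)" for n i
  have "t n C i \<in> A" if "C \<in> marks" for n C i
    using bspec[OF A(2) tX[OF that]] by (auto simp: image_subset_iff)
  then have "range (g n) \<subseteq> marks \<rightarrow>\<^sub>E A" for n
    by (auto simp: g_def PiE_iff extensional_def)
  then obtain z where z: "\<forall>n. \<exists>m\<ge>n. agree n z (g m)"
    using cluster_point[OF finite_PiE[OF finite_marks A(1)], of g] by blast
  define s where "s C = (\<lambda>i. z i C)" for C
  have ag: "\<exists>m\<ge>n. \<forall>C\<in>marks. agree n (s C) (t m C)" for n
  proof -
    obtain m where m: "m \<ge> n" "agree n z (g m)" using z by blast
    have "agree n (s C) (t m C)" if "C \<in> marks" for C
      using m(2) that unfolding agree_def s_def g_def by simp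
    then show ?thesis using m(1) by blast
  qed
  have st: "\<exists>m\<ge>n. \<forall>C\<in>marks. \<forall>k. \<bar>k\<bar> \<le> int n \<longrightarrow> state (s C) k = state (t m C) k" for n
  proof -
    obtain m where m: "m \<ge> n + N" "\<forall>C\<in>marks. agree (n + N) (s C) (t m C)" using ag by blast
    have "state (s C) k = state (t m C) k" if "C \<in> marks" "\<bar>k\<bar> \<le> int n" for C k
      unfolding state_eq_iff using m(2)[rule_format, OF that(1)] that(2) by (simp add: agree_def)
    then show ?thesis using m(1) by (intro exI[of _ m]) simp
  qed
  have sX: "s C \<in> X" if "C \<in> marks" for C
  proof (rule shift_space_limit[OF shift_space])
    fix n
    obtain m where "\<forall>C\<in>marks. agree n (s C) (t m C)" using ag by blast
    then show "\<exists>x\<in>X. agree n (s C) x" using that tX by blast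
  qed
  have "\<pi> (s C) k = \<pi> x0 k" if C: "C \<in> marks" for C k
  proof -
    obtain m where m: "m \<ge> nat \<bar>k\<bar>" "\<forall>C\<in>marks. \<forall>j. \<bar>j\<bar> \<le> int (nat \<bar>k\<bar>) \<longrightarrow> state (s C) j = state (t m C) j"
      using st by blast
    then have "\<pi> (s C) k = \<pi> (t m C) k" using C by (intro image_state sX tX) simp_all
    then show ?thesis using t\<pi>[OF C, of k m] m(1) by simp
  qed
  then have "s C \<in> fibre \<pi> X (\<pi> x0)" if "C \<in> marks" for C using sX[OF that] that by (auto simp: fibre_def)
  moreover have "\<not> linked (\<pi> x0) (state (s C) i) i (state (s D) j) j"
    if CD: "C \<in> marks" "D \<in> marks" "C \<noteq> D" and ij: "i \<le> j" for C D i j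
  proof -
    define n where "n = nat (\<bar>i\<bar> + \<bar>j\<bar>)"
    obtain m where m: "m \<ge> n" "\<forall>C\<in>marks. \<forall>k. \<bar>k\<bar> \<le> int n \<longrightarrow> state (s C) k = state (t m C) k"
      using st by blast
    have "\<bar>i\<bar> \<le> int n" "\<bar>j\<bar> \<le> int n" by (simp_all add: n_def)
    then have "state (s C) i = state (t m C) i" "state (s D) j = state (t m D) j" using m(2) CD by simp_all
    moreover have "- int m \<le> i" "j \<le> int m" using \<open>\<bar>i\<bar> \<le> int n\<close> \<open>\<bar>j\<bar> \<le> int n\<close> m(1) by linarith+
    ultimately show ?thesis using tl[OF CD _ ij] by simp
  qed
  ultimately show ?thesis by (intro exI[of _ s]) simp
qed

lemma transition_linked:
  assumes "transition \<pi> X x x'"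
  shows "\<exists>i j. i \<le> j \<and> linked (\<pi> x) (state x i) i (state x' j) j"
proof -
  obtain z where z: "z \<in> fibre \<pi> X (\<pi> x)" "\<forall>j\<le>int 0. z j = x j" "\<exists>i>int 0. \<forall>j\<ge>i. z j = x' j"
    using assms unfolding transition_def by blast
  then obtain i where i: "i > 0" "\<forall>j\<ge>i. z j = x' j" by auto
  \<comment> \<open>agreement up to \<open>0\<close> and from \<open>i\<close> on covers the full windows around \<open>- N\<close> and \<open>i + N\<close>\<close>
  have "state z (- int N) = state x (- int N)" unfolding state_eq_iff using z(2) by simp
  moreover have "state z (i + int N) = state x' (i + int N)" unfolding state_eq_iff using i(2) by simp
  moreover have "z \<in> X" "\<pi> z = \<pi> x" using z(1) by (simp_all add: fibre_def)
  ultimately have "linked (\<pi> x) (state x (- int N)) (- int N) (state x' (i + int N)) (i + int N)"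
    unfolding linked_def by (intro bexI[of _ z]) simp_all
  then show ?thesis using i(1) by (intro exI[of _ "- int N"] exI[of _ "i + int N"]) simp
qed

text \<open>A transition is in particular a link, so the unlinked tracks lie in different
  classes.\<close>

lemma card_marks_le_transition_classes:
  assumes x0: "x0 \<in> X" and fin: "finite (transition_classes_over \<pi> X (\<pi> x0))"
  shows "card marks \<le> card (transition_classes_over \<pi> X (\<pi> x0))"
proof -
  obtain t where t: "\<forall>C\<in>marks. t C \<in> fibre \<pi> X (\<pi> x0)"
    "\<forall>C\<in>marks. \<forall>D\<in>marks. C \<noteq> D \<longrightarrow> (\<forall>i j. i \<le> j \<longrightarrow> \<not> linked (\<pi> x0) (state (t C) i) i (state (t D) j) j)"
    using unlinked_tracks[OF x0] by (elim exE conjE)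
  have "inj_on (\<lambda>C. transition_equiv \<pi> X `` {t C}) marks"
  proof (rule inj_onI, rule ccontr)
    fix C D assume CD: "C \<in> marks" "D \<in> marks" "C \<noteq> D"
      and eq: "transition_equiv \<pi> X `` {t C} = transition_equiv \<pi> X `` {t D}"
    have tX: "t C \<in> X" "t D \<in> X" "\<pi> (t C) = \<pi> x0" using t(1) CD by (simp_all add: fibre_def)
    have "(t C, t D) \<in> transition_equiv \<pi> X"
      using eq_equiv_class[OF eq equiv_transition_equiv tX(2)] .
    then have "transition \<pi> X (t C) (t D)" by (simp add: transition_equiv_def)
    from transition_linked[OF this] obtain i j where
      "i \<le> j" "linked (\<pi> x0) (state (t C) i) i (state (t D) j) j" using tX(3) by auto
    then show False using t(2) CD by blast
  qed
  moreover have "(\<lambda>C. transition_equiv \<pi> X `` {t C}) ` marks \<subseteq> transition_classes_over \<pi> X (\<pi> x0)"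
    unfolding transition_classes_over_eq using t(1) by blast
  ultimately show ?thesis by (rule card_inj_on_le[OF _ _ fin])
qed

lemma class_degree_eq:
  assumes "Y = \<pi> ` X" "y \<in> Y" "recurrent y"
  shows "class_degree \<pi> X Y = card marks"
  unfolding class_degree_def
proof (rule Least_equality)
  obtain x where x: "x \<in> X" "\<pi> x = y" using assms(1,2) by blast
  have "finite (transition_classes_over \<pi> X y)" "card (transition_classes_over \<pi> X y) \<le> card marks"
    using transition_classes_recurrent_le[OF assms(3)] card_mark_sequences[OF x assms(3)] by simp_all
  moreover from this have "card marks \<le> card (transition_classes_over \<pi> X y)"
    using card_marks_le_transition_classes[OF x(1)] x(2) by simp
  ultimately show "\<exists>y\<in>Y. finite (transition_classes_over \<pi> X y) \<and> card (transition_classes_over \<pi> X y) = card marks"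
    using assms(2) by (intro bexI[of _ y]) simp_all
next
  fix c assume "\<exists>y\<in>Y. finite (transition_classes_over \<pi> X y) \<and> card (transition_classes_over \<pi> X y) = c"
  then obtain x where "x \<in> X" "finite (transition_classes_over \<pi> X (\<pi> x))" "card (transition_classes_over \<pi> X (\<pi> x)) = c"
    using assms(1) by auto
  then show "card marks \<le> c" using card_marks_le_transition_classes by blast
qed

end

section \<open>The factorization\<close>

context marked_setup begin

lemma mark_at_block_code: "block_code (N + length w) X mark_at"
  unfolding block_code_def
proof (intro ballI allI impI)
  fix x x' i i'
  assume x: "x \<in> X" "x' \<in> X" and a: "\<forall>k. \<bar>k\<bar> \<le> int (N + length w) \<longrightarrow> x (i + k) = x' (i' + k)"
  have st: "state x (i + d) = state x' (i' + d)" if "0 \<le> d" "d \<le> L" for d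
    unfolding state_eq_iff
  proof (intro allI impI)
    fix k assume "\<bar>k\<bar> \<le> int N"
    then have "x (i + (d + k)) = x' (i' + (d + k))" using that by (intro a[rule_format]) simp
    then show "x (i + d + k) = x' (i' + d + k)" by (simp add: add.assoc)
  qed
  have "block (\<pi> x) i (length w) = block (\<pi> x') i' (length w)"
    by (intro nth_equalityI) (simp_all add: image_state[OF x] st)
  then have "w_at (\<pi> x) i \<longleftrightarrow> w_at (\<pi> x') i'" by (simp add: w_at_def)
  then show "mark_at x i = mark_at x' i'" using st[of 0] st[of L] by (simp add: mark_at_def)
qed

text \<open>The word \<open>w\<close> is a word of \<open>Y\<close> because \<open>e\<close> is
  nonempty.\<close>

lemma doubly_transitive_recurrent:
  assumes "Y = \<pi> ` X" "shift_space Y" "doubly_transitive Y y"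
  shows "recurrent y"
proof -
  obtain s t where "(s, t) \<in> e" using e_nonempty by auto
  from T_realize[OF this, of 0] obtain x where "x \<in> X" "block (\<pi> x) 0 (length w) = w" by blast
  then have "w \<in> words Y" using assms(1) block_in_words[of "\<pi> x" Y 0 "length w"] by simp
  then show ?thesis
    using assms(3) unfolding doubly_transitive_iff[OF assms(2)] recurrent_def w_at_def by blast
qed

text \<open>The alphabet of the intermediate shift consists of pairs of an image symbol and a
  mark, encoded as natural numbers.\<close>

theorem factor_through_marks:
  assumes sft: "sft X" and \<pi>: "factor_code \<pi> X Y"
  shows "\<exists>(Y' :: (int \<Rightarrow> nat) set) \<pi>\<^sub>1 \<pi>\<^sub>2.
    irreducible_shift Y' \<and> sofic Y' \<and> factor_code \<pi>\<^sub>1 X Y' \<and> factor_code \<pi>\<^sub>2 Y' Y \<and>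
    (\<forall>x\<in>X. \<pi> x = \<pi>\<^sub>2 (\<pi>\<^sub>1 x)) \<and> class_degree \<pi>\<^sub>1 X Y' = 1 \<and>
    finite_to_one \<pi>\<^sub>2 Y' Y \<and> code_degree \<pi>\<^sub>2 Y' Y = class_degree \<pi> X Y"
proof -
  have Y: "Y = \<pi> ` X" and ssY: "shift_space Y" using \<pi> by (simp_all add: factor_code_def)
  obtain B where B: "finite B" "\<forall>y\<in>Y. range y \<subseteq> B" using shift_space_alphabet[OF ssY] by blast
  define P where "P = B \<times> insert {} marks"
  have finP: "finite P" using B(1) finite_marks by (simp add: P_def)
  have inP: "(\<pi> x i, mark_at x i) \<in> P" if "x \<in> X" for x i
  proof -
    have "\<pi> x i \<in> B" using B(2) Y that by auto
    moreover have "mark_at x i \<in> insert {} marks" using mark_at_in_marks[OF that, of i] by (auto simp: mark_at_def)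
    ultimately show ?thesis by (simp add: P_def)
  qed
  obtain enc :: "'b \<times> 'a list set \<Rightarrow> nat" where enc: "inj_on enc P"
    using finite_imp_inj_to_nat_seg[OF finP] by blast
  define \<pi>1 where "\<pi>1 x = (\<lambda>i. enc (\<pi> x i, mark_at x i))" for x
  define \<pi>2 where "\<pi>2 y = (\<lambda>i. fst (inv_into P enc (y i)))" for y :: "int \<Rightarrow> nat"
  define Y' where "Y' = \<pi>1 ` X"
  have \<pi>1_eq: "\<pi>1 x = \<pi>1 x' \<longleftrightarrow> \<pi> x = \<pi> x' \<and> mark_at x = mark_at x'" if "x \<in> X" "x' \<in> X" for x x'
    unfolding \<pi>1_def fun_eq_iff inj_on_eq_iff[OF enc inP[OF that(1)] inP[OF that(2)]] by auto
  have comp: "\<pi>2 (\<pi>1 x) = \<pi> x" if "x \<in> X" for x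
    unfolding \<pi>1_def \<pi>2_def using inP[OF that] enc by simp
  have fc1: "factor_code \<pi>1 X Y'"
    unfolding Y'_def
  proof (rule factor_code_of_block_map[OF shift_space])
    show "finite (enc ` P)" using finP by simp
    show "range (\<pi>1 x) \<subseteq> enc ` P" if "x \<in> X" for x using inP[OF that] by (auto simp: \<pi>1_def)
    show "block_code (N + length w) X \<pi>1"
      unfolding block_code_def
    proof (intro ballI allI impI)
      fix x x' i i'
      assume x: "x \<in> X" "x' \<in> X" and a: "\<forall>k. \<bar>k\<bar> \<le> int (N + length w) \<longrightarrow> x (i + k) = x' (i' + k)"
      have "\<pi> x i = \<pi> x' i'"
        by (rule block_codeD[OF block_code_mono[OF radius, of "N + length w"] x]) (use a in auto)
      moreover have "mark_at x i = mark_at x' i'"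
        by (rule block_codeD[OF mark_at_block_code x]) (use a in auto)
      ultimately show "\<pi>1 x i = \<pi>1 x' i'" by (simp add: \<pi>1_def)
    qed
  qed
  have ssY': "shift_space Y'" using fc1 by (simp add: factor_code_def)
  have im2: "\<pi>2 ` Y' = Y" unfolding Y'_def Y image_image using comp by simp
  have "factor_code \<pi>2 Y' (\<pi>2 ` Y')"
  proof (rule factor_code_of_block_map[OF ssY' B(1)])
    show "range (\<pi>2 y) \<subseteq> B" if "y \<in> Y'" for y using B(2) im2 that by blast
    show "block_code 0 Y' \<pi>2" unfolding block_code_def \<pi>2_def by simp
  qed
  then have fc2: "factor_code \<pi>2 Y' Y" unfolding im2 .
  have fib: "fibre \<pi>2 Y' y = \<pi>1 ` fibre \<pi> X y" for y
    unfolding fibre_def Y'_def using comp by auto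
  have fib_eq: "\<pi>1 x = \<pi>1 x' \<longleftrightarrow> mark_at x = mark_at x'" if "x \<in> fibre \<pi> X y" "x' \<in> fibre \<pi> X y" for x x' y
    using that \<pi>1_eq by (simp add: fibre_def)
  have fin: "finite (\<pi>1 ` fibre \<pi> X y)" "card (\<pi>1 ` fibre \<pi> X y) \<le> card (mark_at ` fibre \<pi> X y)" for y
    by (rule card_image_factor_le[OF finite_mark_sequences], use fib_eq in blast)+
  have ge: "card (mark_at ` fibre \<pi> X y) \<le> card (\<pi>1 ` fibre \<pi> X y)" for y
    by (rule card_image_factor_le(2)[OF fin(1)]) (use fib_eq in blast)
  have rec: "recurrent y" if "doubly_transitive Y y" for y
    using doubly_transitive_recurrent[OF Y ssY that] .
  have card_fib: "card (fibre \<pi>2 Y' y) = card marks" if "doubly_transitive Y y" for y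
  proof -
    have "y \<in> Y" using that by (simp add: doubly_transitive_def)
    then obtain x where x: "x \<in> X" "\<pi> x = y" using Y by blast
    show ?thesis
      using card_mark_sequences[OF x rec[OF that]] fin(2)[of y] ge[of y] unfolding fib by simp
  qed
  have irrY: "irreducible_shift Y" by (rule irreducible_factor[OF irreducible \<pi>])
  obtain y0 where y0: "doubly_transitive Y y0"
    using doubly_transitive_exists[OF irrY] nonempty Y by blast
  have "y0 \<in> Y" using y0 by (simp add: doubly_transitive_def)
  then obtain x0 where x0: "x0 \<in> X" "\<pi> x0 = y0" using Y by blast
  have deg: "class_degree \<pi> X Y = card marks"
    by (rule class_degree_eq[OF Y \<open>y0 \<in> Y\<close> rec[OF y0]])
  have "code_degree \<pi>2 Y' Y = card marks"
    unfolding code_degree_def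
  proof (rule the_equality)
    show "\<forall>y. doubly_transitive Y y \<longrightarrow> card (fibre \<pi>2 Y' y) = card marks" using card_fib by blast
    show "d = card marks" if "\<forall>y. doubly_transitive Y y \<longrightarrow> card (fibre \<pi>2 Y' y) = d" for d
      using that y0 card_fib by metis
  qed
  moreover have "finite_to_one \<pi>2 Y' Y" unfolding finite_to_one_def fib using fin(1) by blast
  moreover have "class_degree \<pi>1 X Y' = 1"
  proof (rule class_degree_1[OF Y'_def x0(1)])
    fix x x' assume x: "x \<in> X" "x' \<in> X" and eq: "\<pi>1 x = \<pi>1 x0" "\<pi>1 x' = \<pi>1 x0"
    have e1: "\<pi> x = \<pi> x0" "mark_at x = mark_at x0" "\<pi> x' = \<pi> x0" "mark_at x' = mark_at x0"
      using eq \<pi>1_eq x x0(1) by simp_all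
    have rx: "recurrent (\<pi> x)" using rec[OF y0] x0(2) e1(1) by simp
    have "\<exists>z\<in>fibre \<pi>1 X (\<pi>1 x). (\<forall>j\<le>int n. z j = x j) \<and> (\<exists>i>int n. \<forall>j\<ge>i. z j = x' j)" for n
    proof -
      have "\<pi> x = \<pi> x'" "mark_at x = mark_at x'" using e1 by simp_all
      from same_marks_transition[OF x this rx] obtain z where z: "z \<in> X" "\<pi> z = \<pi> x" "mark_at z = mark_at x"
        "\<forall>j\<le>int n. z j = x j" "\<exists>i>int n. \<forall>j\<ge>i. z j = x' j" by blast
      have "z \<in> fibre \<pi>1 X (\<pi>1 x)" using z(1-3) \<pi>1_eq[OF z(1) x(1)] by (simp add: fibre_def)
      then show ?thesis using z(4,5) by blast
    qed
    then show "transition \<pi>1 X x x'" unfolding transition_def using x eq by simp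
  qed
  moreover have "irreducible_shift Y'" by (rule irreducible_factor[OF irreducible fc1])
  moreover have "sofic Y'" by (rule sofic_factor[OF sft fc1])
  moreover have "\<forall>x\<in>X. \<pi> x = \<pi>2 (\<pi>1 x)" using comp by simp
  ultimately show ?thesis using fc1 fc2 deg by (intro exI[of _ Y'] exI[of _ \<pi>1] exI[of _ \<pi>2]) simp
qed

end

theorem theorem3p4:
  fixes X :: "(int \<Rightarrow> 'a) set" and Y :: "(int \<Rightarrow> 'b) set"
    and \<pi> :: "(int \<Rightarrow> 'a) \<Rightarrow> (int \<Rightarrow> 'b)"
  assumes "sft X" and "irreducible_shift X" and "X \<noteq> {}"
    and "sofic Y"
    and "factor_code \<pi> X Y"
  shows "\<exists>(Y' :: (int \<Rightarrow> nat) set) (\<pi>\<^sub>1 :: (int \<Rightarrow> 'a) \<Rightarrow> (int \<Rightarrow> nat))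
           (\<pi>\<^sub>2 :: (int \<Rightarrow> nat) \<Rightarrow> (int \<Rightarrow> 'b)).
           irreducible_shift Y' \<and> sofic Y' \<and>
           factor_code \<pi>\<^sub>1 X Y' \<and> factor_code \<pi>\<^sub>2 Y' Y \<and>
           (\<forall>x\<in>X. \<pi> x = \<pi>\<^sub>2 (\<pi>\<^sub>1 x)) \<and>
           class_degree \<pi>\<^sub>1 X Y' = 1 \<and>
           finite_to_one \<pi>\<^sub>2 Y' Y \<and>
           code_degree \<pi>\<^sub>2 Y' Y = class_degree \<pi> X Y"
proof -
  obtain r where r: "block_code r X \<pi>" using sliding_block[OF assms(5)] by blast
  obtain M where M: "\<forall>N\<ge>M. \<forall>x\<in>X. \<forall>x'\<in>X. \<forall>i. (\<forall>k. \<bar>k\<bar> \<le> int N \<longrightarrow> x (i + k) = x' (i + k)) \<longrightarrow>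
    (\<lambda>j. if j \<le> i then x j else x' j) \<in> X" using sft_splice[OF assms(1)] by blast
  define N where "N = max r M"
  interpret factor_setup X \<pi> N
  proof
    show "block_code N X \<pi>" by (rule block_code_mono[OF r]) (simp add: N_def)
    show "(\<lambda>j. if j \<le> i then x j else x' j) \<in> X"
      if "x \<in> X" "x' \<in> X" "\<forall>k. \<bar>k\<bar> \<le> int N \<longrightarrow> x (i + k) = x' (i + k)" for x x' i
    proof -
      have "M \<le> N" by (simp add: N_def)
      then show ?thesis using M that by blast
    qed
  qed (fact assms)+
  obtain w where w: "minimal_idempotent w" using minimal_idempotent_exists by blast
  interpret marked_setup X \<pi> N w by unfold_locales (rule w)
  show ?thesis by (rule factor_through_marks[OF assms(1,5)])
qed

end
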